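(* There exists a family of finitely generated groups $\{G_r : r\in\mathbb{R}\}$ such that for all $r,s\in\mathbb{R}$ with $r\neq s$ there is no regular map $G_r\to G_s$.
   Context: A finitely generated group is regarded as a graph via its Cayley graph with respect to a finite generating set, with the shortest path (word) metric; the existence of regular maps does not depend on the choice of finite generating sets. A map $\phi:VX\to VX'$ between the vertex sets of two graphs is regular if it is Lipschitz and there is a uniform bound on the cardinality of the pre-images $\phi^{-1}(v)$ of vertices $v$ of $X'$. *)

theory Defs
  imports
    "HOL-Algebra.Generated_Groups"
    "Graph_Theory.Pair_Digraph"
    "Graph_Theory.Shortest_Path"
begin

text \<open>Undirected graphs are represented as symmetric digraphs.\<close>

definition graph_dist :: "('a, 'b) pre_digraph \<Rightarrow> 'a \<Rightarrow> 'a \<Rightarrow> ereal" where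
  "graph_dist X u v = wf_digraph.\<mu> X (\<lambda>_. 1) u v"

text \<open>
  Vertices in different components are at distance \<open>\<infinity>\<close>, so the Lipschitz inequality (with
  \<open>K > 0\<close>) does not constrain them. The preimages have to be explicitly finite, since the
  cardinality of an infinite set is \<open>0\<close>.
\<close>

definition regular_map :: "('a, 'b) pre_digraph \<Rightarrow> ('c, 'd) pre_digraph \<Rightarrow> ('a \<Rightarrow> 'c) \<Rightarrow> bool" where
  "regular_map X Y \<phi> \<longleftrightarrow>
     \<phi> ` verts X \<subseteq> verts Y \<and>
     (\<exists>K::real. K > 0 \<and> (\<forall>x\<in>verts X. \<forall>y\<in>verts X.
        graph_dist Y (\<phi> x) (\<phi> y) \<le> ereal K * graph_dist X x y)) \<and>
     (\<exists>N::nat. \<forall>v\<in>verts Y.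
        finite {x \<in> verts X. \<phi> x = v} \<and> card {x \<in> verts X. \<phi> x = v} \<le> N)"

definition finite_generating_set :: "('a, 'm) monoid_scheme \<Rightarrow> 'a set \<Rightarrow> bool" where
  "finite_generating_set G S \<longleftrightarrow> finite S \<and> S \<subseteq> carrier G \<and> generate G S = carrier G"

text \<open>
  Finitely generated groups are countable, so each of them is isomorphic to one of type
  \<open>nat monoid\<close>.
\<close>

definition finitely_generated_group :: "('a, 'm) monoid_scheme \<Rightarrow> bool" where
  "finitely_generated_group G \<longleftrightarrow> group G \<and> (\<exists>S. finite_generating_set G S)"

text \<open>
  The simple Cayley graph: \<open>g\<close> and \<open>h\<close> are adjacent iff \<open>g \<noteq> h\<close> and one is obtained from the
  other by right multiplication by an element of \<open>S\<close>. The set \<open>S\<close> need not be symmetric.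
\<close>

definition cayley_graph :: "('a, 'm) monoid_scheme \<Rightarrow> 'a set \<Rightarrow> ('a, 'a \<times> 'a) pre_digraph" where
  "cayley_graph G S = with_proj
     \<lparr> pverts = carrier G,
       parcs = {(g, h). g \<in> carrier G \<and> h \<in> carrier G \<and> g \<noteq> h \<and>
                        (\<exists>s\<in>S. h = g \<otimes>\<^bsub>G\<^esub> s \<or> g = h \<otimes>\<^bsub>G\<^esub> s)} \<rparr>"

lemma wf_digraph_cayley_graph: "wf_digraph (cayley_graph G S)"
  by unfold_locales (auto simp: cayley_graph_def with_proj_def)

lemma symmetric_cayley_graph: "symmetric (cayley_graph G S)"
  by (auto simp: symmetric_def arcs_ends_def arc_to_ends_def cayley_graph_def with_proj_def
      sym_def image_iff)

end

theory Submission
  imports Defs "HOL-Library.Countable_Set" "HOL-Algebra.Weak_Morphisms"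
begin

text \<open>
  Let \<open>V\<^sub>j\<close> be the ball of radius \<open>g j\<close> in the 3-regular tree with properly 3-coloured edges; colour
  \<open>k\<close> acts on \<open>V\<^sub>j\<close> by the involution that flips its edges. For a set \<open>X\<close> of naturals the group
  \<open>G\<^sub>X\<close> acts on points \<open>(p, j, v)\<close> with \<open>p\<close> an integer and \<open>v\<close> in \<open>V\<^sub>j\<close>: it is generated by the
  shift of \<open>p\<close> and by three involutions, the \<open>k\<close>-th of which applies colour \<open>k\<close> on the fibres over
  \<open>p = k s\<^sub>j\<close> with \<open>j \<in> X\<close>, where \<open>s\<close> grows fast. Conjugating the involutions by powers of the shift so
  that all three act at \<open>p = 0\<close> on \<open>V\<^sub>i\<close>, for \<open>i \<in> X\<close>, yields a finite subgroup \<open>Q\<close> whose Cayley graph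
  is a tree up to radius \<open>g i\<close>. Hence \<open>Q\<close> cannot be cut into pieces smaller than \<open>g i\<close> by removing
  fewer than a quarter of its vertices.

  If \<open>i \<notin> Y\<close>, then a subgroup of \<open>G\<^sub>Y\<close> generated by involutions at positions in a window of length
  comparable to \<open>s\<^sub>i\<close> is finite, of order bounded in terms of \<open>g j\<close> for \<open>j < i\<close> only: for \<open>j > i\<close>
  the involutions have disjoint supports. Pulling back a periodic family of gaps along a regular map
  \<open>Q \<rightarrow> G\<^sub>Y \<rightarrow> \<int>\<close> therefore cuts \<open>Q\<close> into small pieces at the cost of a fifth of its vertices, a
  contradiction if \<open>g i\<close> was chosen large enough. So there is no regular map \<open>G\<^sub>X \<rightarrow> G\<^sub>Y\<close> as soon as
  \<open>X - Y\<close> is infinite, and an almost disjoint family of sets indexed by the reals gives the theorem.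
\<close>

section \<open>Products of involutions\<close>

definition comp_list :: "('a \<Rightarrow> 'a) list \<Rightarrow> 'a \<Rightarrow> 'a" where
  "comp_list l = foldr (\<circ>) l id"

lemma comp_list_simps [simp]:
  "comp_list [] = id"
  "comp_list (f # l) = f \<circ> comp_list l"
  "comp_list (l @ l') = comp_list l \<circ> comp_list l'"
proof -
  show "comp_list [] = id" and *: "comp_list (f # l) = f \<circ> comp_list l" for f l
    by (simp_all add: comp_list_def)
  show "comp_list (l @ l') = comp_list l \<circ> comp_list l'"
    by (induction l) (simp_all add: comp_list_def o_assoc)
qed

text \<open>On the orbit of \<open>x\<close> under the involution \<open>z a\<close> all other
  factors act trivially, so only the parity of the number of factors \<open>z a\<close>
  matters.\<close>

lemma comp_list_involution_eq:
  assumes "z a (z a x) = x"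
    and "\<And>b. b \<in> set l \<Longrightarrow> b \<noteq> a \<Longrightarrow> z b x = x \<and> z b (z a x) = z a x"
  shows "comp_list (map z l) x = (if odd (count_list l a) then z a x else x)"
  using assms(2)
proof (induction l)
  case (Cons b l)
  then have IH: "comp_list (map z l) x = (if odd (count_list l a) then z a x else x)"
    by simp
  show ?case
    using Cons.prems[of b] IH assms(1) by (cases "b = a") auto
qed simp

text \<open>
  A product is determined by its restriction to \<open>F\<close> together with the parities of the
  numbers of occurrences of the generators.
\<close>

lemma card_products_le:
  fixes z :: "'i \<Rightarrow> 'a \<Rightarrow> 'a"
  assumes I: "finite I" and F: "finite F"
    and inv: "\<And>a x. a \<in> I \<Longrightarrow> x \<in> F \<Longrightarrow> z a x \<in> F"
    and out: "\<And>x. x \<notin> F \<Longrightarrow> \<exists>a. z a (z a x) = x \<and>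
                (\<forall>b\<in>I. b \<noteq> a \<longrightarrow> z b x = x \<and> z b (z a x) = z a x)"
  shows "finite (comp_list ` map z ` lists I)"
    and "card (comp_list ` map z ` lists I) \<le> card F ^ card F * 2 ^ card I"
proof -
  define cl where "cl = (\<lambda>l. comp_list (map z l))"
  define key where "key = (\<lambda>l. (restrict (cl l) F, {a \<in> I. odd (count_list l a)}))"
  define K where "K = (F \<rightarrow>\<^sub>E F) \<times> Pow I"
  have clF: "cl l x \<in> F" if "l \<in> lists I" "x \<in> F" for l x
    using that(1)
  proof (induction l)
    case (Cons a l)
    then show ?case using inv by (simp add: cl_def)
  qed (use that(2) in \<open>simp add: cl_def\<close>)
  have finK: "finite K"
    using I F by (auto simp: K_def intro!: finite_PiE)
  have cardK: "card K = card F ^ card F * 2 ^ card I"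
    using I F by (simp add: K_def card_cartesian_product card_PiE card_Pow)
  have keyK: "key ` lists I \<subseteq> K"
  proof (rule image_subsetI)
    fix l assume "l \<in> lists I"
    then have "\<forall>x\<in>F. cl l x \<in> F"
      by (intro ballI clF)
    then have "restrict (cl l) F \<in> F \<rightarrow>\<^sub>E F"
      by (subst restrict_PiE_iff)
    then show "key l \<in> K"
      unfolding key_def K_def by (intro SigmaI PowI) (assumption, blast)
  qed
  have key_eq: "cl l = cl l'" if "l \<in> lists I" "l' \<in> lists I" "key l = key l'" for l l'
  proof
    fix x
    show "cl l x = cl l' x"
    proof (cases "x \<in> F")
      case True
      have "restrict (cl l) F = restrict (cl l') F"
        using that(3) by (simp add: key_def)
      then have "restrict (cl l) F x = restrict (cl l') F x"
        by (rule fun_cong)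
      with True show ?thesis by simp
    next
      case False
      then obtain a where a: "z a (z a x) = x"
        "\<And>b. b \<in> I \<Longrightarrow> b \<noteq> a \<Longrightarrow> z b x = x \<and> z b (z a x) = z a x"
        using out by blast
      have eq: "cl l x = (if odd (count_list l a) then z a x else x)" if "l \<in> lists I" for l
        unfolding cl_def
      proof (rule comp_list_involution_eq[where z = z and a = a and x = x, OF a(1)])
        fix b assume "b \<in> set l" "b \<noteq> a"
        with that show "z b x = x \<and> z b (z a x) = z a x"
          by (intro a(2)) auto
      qed
      have "odd (count_list l a) \<longleftrightarrow> odd (count_list l' a)"
      proof (cases "a \<in> I")
        case True
        have "{a \<in> I. odd (count_list l a)} = {a \<in> I. odd (count_list l' a)}"
          using that(3) by (simp add: key_def)
        with True show ?thesis by blast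
      next
        case False
        \<comment> \<open>The index supplied by \<open>out\<close> may lie outside of
          \<open>I\<close>; then it occurs in neither word and both counts are zero.\<close>
        then have "a \<notin> set l" "a \<notin> set l'"
          using that(1,2) by auto
        then show ?thesis by (simp add: count_list_0_iff)
      qed
      then show ?thesis
        by (simp only: eq[OF that(1)] eq[OF that(2)])
    qed
  qed
  define h where "h = (\<lambda>k. cl (SOME l. l \<in> lists I \<and> key l = k))"
  have "cl l = h (key l)" if "l \<in> lists I" for l
  proof -
    have "\<exists>l'. l' \<in> lists I \<and> key l' = key l"
      using that by blast
    from someI_ex[OF this] show ?thesis
      unfolding h_def using key_eq that by metis
  qed
  then have eq: "comp_list ` map z ` lists I = h ` key ` lists I"
    by (auto simp: cl_def image_iff intro!: bexI)
  show "finite (comp_list ` map z ` lists I)"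
    unfolding eq using finK keyK finite_subset by blast
  have "card (h ` key ` lists I) \<le> card (key ` lists I)"
    using finK keyK by (intro card_image_le) (rule finite_subset)
  also have "\<dots> \<le> card K"
    using finK keyK by (rule card_mono)
  finally show "card (comp_list ` map z ` lists I) \<le> card F ^ card F * 2 ^ card I"
    unfolding eq cardK .
qed

section \<open>Trees and separators\<close>

text \<open>Reduced words in the free product of three groups of order two, whose Cayley graph is
  the 3-regular tree; the length of a word is its distance to the root \<open>[]\<close>.\<close>

definition reduced_words :: "nat \<Rightarrow> nat list set" where
  "reduced_words n = {w. distinct_adj w \<and> set w \<subseteq> {..<3} \<and> length w \<le> n}"

lemma finite_reduced_words: "finite (reduced_words n)"
  using finite_lists_length_le[of "{..<3::nat}" n]
  by (rule rev_finite_subset) (auto simp: reduced_words_def)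

text \<open>
  Vertices of the tree are reduced words. An edge leads from a word to its tail and is coloured by
  its head; outside of \<open>k < 3\<close> and \<open>reduced_words n\<close> the function is the identity.
\<close>

definition toggle :: "nat \<Rightarrow> nat \<Rightarrow> nat list \<Rightarrow> nat list" where
  "toggle n k w =
     (if k < 3 \<and> w \<in> reduced_words n then
        if w \<noteq> [] \<and> hd w = k then tl w else if length w < n then k # w else w
      else w)"

lemma toggle_in_reduced_words: "w \<in> reduced_words n \<Longrightarrow> toggle n k w \<in> reduced_words n"
  by (cases w) (auto simp: toggle_def reduced_words_def distinct_adj_Cons)

text \<open>A leaf of the ball is fixed by the colours of its missing edges, so cutting the tree off
  at radius \<open>n\<close> leaves each colour an involution.\<close>

lemma toggle_toggle: "toggle n k (toggle n k w) = w"
  by (cases w) (auto simp: toggle_def reduced_words_def distinct_adj_Cons)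

lemma toggle_Cons: "k # w \<in> reduced_words n \<Longrightarrow> toggle n k w = k # w"
  by (cases w) (auto simp: toggle_def reduced_words_def distinct_adj_Cons)

text \<open>
  If every vertex of a nonempty subset had two neighbours in it, one could walk on forever without
  backtracking. So vertices can be removed one by one, each together with at most one edge; each
  edge is counted twice, once from each end.
\<close>

lemma no_long_walks_imp_sparse:
  fixes nb :: "nat \<Rightarrow> 'a \<Rightarrow> 'a"
  assumes "finite S"
    and nb_nb: "\<And>k q. k < 3 \<Longrightarrow> nb k (nb k q) = q"
    and no_walk: "\<And>q w. distinct_adj w \<Longrightarrow> set w \<subseteq> {..<3} \<Longrightarrow> length w = n \<Longrightarrow>
       \<exists>m\<le>n. foldl (\<lambda>q k. nb k q) q (take m w) \<notin> S"
  shows "card {(q, k). q \<in> S \<and> k < 3 \<and> nb k q \<in> S} \<le> 2 * card S"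
  using assms(1,3)
proof (induction "card S" arbitrary: S)
  case 0
  then show ?case by simp
next
  case (Suc c)
  let ?walk = "foldl (\<lambda>q k. nb k q)"
  have "\<exists>v\<in>S. card {k. k < 3 \<and> nb k v \<in> S} \<le> 1"
  proof (rule ccontr)
    assume "\<not> ?thesis"
    then have deg: "card {k. k < 3 \<and> nb k v \<in> S} \<ge> 2" if "v \<in> S" for v
      using that by force
    obtain q where q: "q \<in> S"
      using Suc.hyps(2) by fastforce
    have "\<exists>w. distinct_adj w \<and> set w \<subseteq> {..<3} \<and> length w = l \<and>
             (\<forall>m\<le>l. ?walk q (take m w) \<in> S)" for l
    proof (induction l)
      case 0
      show ?case using q by (intro exI[of _ "[]"]) auto
    next
      case (Suc l)
      then obtain w where w: "distinct_adj w" "set w \<subseteq> {..<3}" "length w = l"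
        "\<And>m. m \<le> l \<Longrightarrow> ?walk q (take m w) \<in> S" by blast
      have "?walk q w \<in> S"
        using w(3) w(4)[of l] by simp
      then have "2 \<le> card {k. k < 3 \<and> nb k (?walk q w) \<in> S}"
        by (rule deg)
      \<comment> \<open>At least two colours lead back into \<open>S\<close>, so one of them differs
        from the last letter and prolongs the walk without backtracking. For the empty word
        \<open>last w\<close> is an unspecified number, and the same count applies.\<close>
      moreover have "card {k. k < 3 \<and> nb k (?walk q w) \<in> S} \<le> card {last w}"
        if "{k. k < 3 \<and> nb k (?walk q w) \<in> S} \<subseteq> {last w}"
        using that by (intro card_mono) auto
      ultimately have "\<not> {k. k < 3 \<and> nb k (?walk q w) \<in> S} \<subseteq> {last w}"
        by auto
      then obtain k where k: "k < 3" "nb k (?walk q w) \<in> S" "k \<noteq> last w" by blast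
      have "?walk q (take m (w @ [k])) \<in> S" if "m \<le> Suc l" for m
        using w k that by (cases "m = Suc l") auto
      with w k show ?case
        by (intro exI[of _ "w @ [k]"]) (auto simp: distinct_adj_append_iff)
    qed
    from this[of n] show False
      using Suc.prems(2) by blast
  qed
  then obtain v where v: "v \<in> S" "card {k. k < 3 \<and> nb k v \<in> S} \<le> 1" by blast
  let ?E = "\<lambda>S. {(q, k). q \<in> S \<and> k < 3 \<and> nb k q \<in> S}"
  let ?K = "{k. k < 3 \<and> nb k v \<in> S}"
  let ?S = "S - {v}"
  have cS: "card S = Suc (card ?S)"
    using v(1) Suc.prems(1) by (metis card.remove)
  have IH: "card (?E ?S) \<le> 2 * card ?S"
  proof (rule Suc.hyps(1))
    show "\<exists>m\<le>n. ?walk q (take m w) \<notin> ?S"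
      if "distinct_adj w" "set w \<subseteq> {..<3}" "length w = n" for q w
      using Suc.prems(2)[OF that] by blast
  qed (use Suc cS in auto)
  \<comment> \<open>Only pairs that start or end at \<open>v\<close> are lost with it. Those ending
    there start at \<open>nb k v\<close>, because \<open>nb k\<close> is an involution, so both
    kinds are indexed by \<open>?K\<close>, which has at most one element.\<close>
  have "?E S \<subseteq> ?E ?S \<union> Pair v ` ?K \<union> (\<lambda>k. (nb k v, k)) ` ?K" (is "_ \<subseteq> ?R")
  proof (rule subrelI)
    fix q k assume "(q, k) \<in> ?E S"
    then have *: "q \<in> S" "k < 3" "nb k q \<in> S" by auto
    consider "q = v" | "nb k q = v" | "q \<noteq> v" "nb k q \<noteq> v" by blast
    then show "(q, k) \<in> ?R"
    proof cases
      case 2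
      then have "q = nb k v" using * nb_nb by metis
      then have "(q, k) \<in> (\<lambda>k. (nb k v, k)) ` ?K"
        using * by (intro image_eqI[of _ _ k]) auto
      then show ?thesis by blast
    qed (use * in auto)
  qed
  moreover have "finite (?E ?S)"
    using Suc.prems(1) by (intro finite_subset[of "?E ?S" "S \<times> {..<3}"]) auto
  ultimately have "card (?E S) \<le> card ?R"
    by (intro card_mono) auto
  also have "\<dots> \<le> card (?E ?S) + card (Pair v ` ?K) + card ((\<lambda>k. (nb k v, k)) ` ?K)"
    by (rule order.trans[OF card_Un_le]) (intro add_right_mono card_Un_le)
  also have "\<dots> \<le> card (?E ?S) + card ?K + card ?K"
    by (intro add_mono card_image_le) auto
  also have "\<dots> \<le> 2 * card S"
    using IH v(2) cS by linarith
  finally show ?case .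
qed

text \<open>Of the three pairs of a colour and a given vertex of \<open>Q - R\<close>, on average at
  most two stay in \<open>Q - R\<close>. So at least \<open>card (Q - R)\<close> pairs lead into
  \<open>R\<close>, where each vertex is hit at most three times.\<close>

lemma card_le_separator:
  fixes nb :: "nat \<Rightarrow> 'a \<Rightarrow> 'a"
  assumes Q: "finite Q" and R: "R \<subseteq> Q"
    and nb: "\<And>k q. k < 3 \<Longrightarrow> q \<in> Q \<Longrightarrow> nb k q \<in> Q"
    and nb_nb: "\<And>k q. k < 3 \<Longrightarrow> nb k (nb k q) = q"
    and no_walk: "\<And>q w. distinct_adj w \<Longrightarrow> set w \<subseteq> {..<3} \<Longrightarrow> length w = n \<Longrightarrow>
       \<exists>m\<le>n. foldl (\<lambda>q k. nb k q) q (take m w) \<notin> Q - R"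
  shows "card Q \<le> 4 * card R"
proof -
  let ?S = "Q - R"
  let ?E = "{(q, k). q \<in> ?S \<and> k < 3 \<and> nb k q \<in> ?S}"
  let ?B = "{(q, k). q \<in> ?S \<and> k < 3 \<and> nb k q \<in> R}"
  have finR: "finite R"
    using Q R by (rule rev_finite_subset)
  have "3 * card ?S = card (?S \<times> {..<3::nat})"
    by (simp add: card_cartesian_product)
  also have "?S \<times> {..<3} = ?E \<union> ?B"
    using nb by auto
  also have "card \<dots> \<le> card ?E + card ?B"
    by (rule card_Un_le)
  also have "card ?E \<le> 2 * card ?S"
    using Q nb_nb no_walk by (intro no_long_walks_imp_sparse) auto
  also have "card ?B \<le> card (R \<times> {..<3::nat})"
  proof (rule card_inj_on_le)
    have "q = q'" if "k < 3" "nb k q = nb k q'" for q q' k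
      using that nb_nb by metis
    then show "inj_on (\<lambda>(q, k). (nb k q, k)) ?B"
      by (auto simp: inj_on_def)
  qed (use finR in auto)
  finally have "card ?S \<le> 3 * card R"
    by (simp add: card_cartesian_product)
  moreover have "card Q = card ?S + card R"
    using Q R by (simp add: card_Diff_subset card_mono finR)
  ultimately show ?thesis by linarith
qed

section \<open>Regular maps between Cayley graphs\<close>

lemma cayley_graph_simps:
  "verts (cayley_graph G S) = carrier G"
  "tail (cayley_graph G S) = fst"
  "head (cayley_graph G S) = snd"
  "e \<in> arcs (cayley_graph G S) \<longleftrightarrow>
     fst e \<in> carrier G \<and> snd e \<in> carrier G \<and> fst e \<noteq> snd e \<and>
     (\<exists>s\<in>S. snd e = fst e \<otimes>\<^bsub>G\<^esub> s \<or> fst e = snd e \<otimes>\<^bsub>G\<^esub> s)"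
  by (auto simp: cayley_graph_def with_proj_def)

lemma awalk_imp_graph_dist_le:
  assumes "wf_digraph X" "pre_digraph.awalk X u p v"
  shows "graph_dist X u v \<le> ereal (length p)"
proof -
  interpret wf_digraph X by fact
  show ?thesis
    using min_cost_le_walk_cost[OF assms(2), of "\<lambda>_. 1"]
    by (simp add: graph_dist_def awalk_cost_def sum_list_triv)
qed

text \<open>The strict bound \<open>n + 1\<close> on the infimum is witnessed by a walk, and lengths
  are integers, so that walk has at most \<open>n\<close> arcs.\<close>

lemma graph_dist_le_imp_awalk:
  assumes "wf_digraph X" "graph_dist X u v \<le> ereal (real n)"
  shows "\<exists>p. pre_digraph.awalk X u p v \<and> length p \<le> n"
proof -
  interpret wf_digraph X by fact
  have "graph_dist X u v < ereal (real n + 1)"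
    using assms(2) by (rule order.strict_trans1) simp
  then obtain p where "awalk u p v" "ereal (awalk_cost (\<lambda>_. 1) p) < ereal (real n + 1)"
    unfolding graph_dist_def \<mu>_def INF_less_iff by blast
  then show ?thesis
    by (intro exI[of _ p]) (simp add: awalk_cost_def sum_list_triv)
qed

section \<open>Words in generators and walks in the Cayley graph\<close>

context group
begin

text \<open>The length depends only on how \<open>x\<close> is built from generators, not on the
  starting point: a generator or its inverse costs at most one arc, and products concatenate
  walks.\<close>

lemma awalk_mult_generate:
  assumes S: "S \<subseteq> carrier G" and "x \<in> generate G S"
  shows "\<exists>n. \<forall>g\<in>carrier G. \<exists>p. pre_digraph.awalk (cayley_graph G S) g p (g \<otimes> x) \<and> length p \<le> n"
proof -
  interpret X: wf_digraph "cayley_graph G S" by (rule wf_digraph_cayley_graph)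
  have step: "\<exists>p. X.awalk g p h \<and> length p \<le> 1"
    if "g \<in> carrier G" "h \<in> carrier G" "s \<in> S" "h = g \<otimes> s \<or> g = h \<otimes> s" for g h s
  proof (cases "g = h")
    \<comment> \<open>The Cayley graph has no loops, so a trivial step is matched by the empty
      walk.\<close>
    case True
    with that show ?thesis
      by (intro exI[of _ "[]"]) (simp add: X.awalk_Nil_iff cayley_graph_simps)
  next
    case False
    with that show ?thesis
      by (intro exI[of _ "[(g, h)]"]) (auto simp: X.awalk_simps cayley_graph_simps)
  qed
  show ?thesis using assms(2)
  proof (induction rule: generate.induct)
    case one
    show ?case
      by (intro exI[of _ 0] ballI exI[of _ "[]"]) (auto simp: X.awalk_Nil_iff cayley_graph_simps)
  next
    case (incl h)
    then show ?case
      using S by (intro exI[of _ 1] ballI step[of _ _ h]) auto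
  next
    case (inv h)
    then have "h \<in> carrier G"
      using S by blast
    with inv show ?case
      by (intro exI[of _ 1] ballI step[of _ _ h]) (auto simp: m_assoc)
  next
    case (eng h1 h2)
    then have h: "h1 \<in> carrier G" "h2 \<in> carrier G"
      using generate_in_carrier[OF S] by auto
    obtain m n where
      m: "\<And>g. g \<in> carrier G \<Longrightarrow> \<exists>p. X.awalk g p (g \<otimes> h1) \<and> length p \<le> m" and
      n: "\<And>g. g \<in> carrier G \<Longrightarrow> \<exists>p. X.awalk g p (g \<otimes> h2) \<and> length p \<le> n"
      using eng.IH by blast
    show ?case
    proof (intro exI[of _ "m + n"] ballI)
      fix g assume g: "g \<in> carrier G"
      obtain p where p: "X.awalk g p (g \<otimes> h1)" "length p \<le> m"
        using m[OF g] by blast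
      obtain q where q: "X.awalk (g \<otimes> h1) q (g \<otimes> h1 \<otimes> h2)" "length q \<le> n"
        using n[of "g \<otimes> h1"] g h by blast
      show "\<exists>p. X.awalk g p (g \<otimes> (h1 \<otimes> h2)) \<and> length p \<le> m + n"
        using p q g h by (intro exI[of _ "p @ q"]) (auto simp: m_assoc X.awalk_ends intro: X.awalk_appendI)
    qed
  qed
qed

definition word_prod :: "'a list \<Rightarrow> 'a" where
  "word_prod l = foldr (\<otimes>) l \<one>"

lemma word_prod_simps [simp]:
  "word_prod [] = \<one>" "word_prod (x # l) = x \<otimes> word_prod l"
  by (simp_all add: word_prod_def)

lemma word_prod_closed [simp]: "set l \<subseteq> carrier G \<Longrightarrow> word_prod l \<in> carrier G"
  by (induction l) auto

lemma word_prod_append: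
  "set l \<subseteq> carrier G \<Longrightarrow> set l' \<subseteq> carrier G \<Longrightarrow> word_prod (l @ l') = word_prod l \<otimes> word_prod l'"
  by (induction l) (auto simp: m_assoc)

lemma generate_imp_word_prod:
  assumes "B \<subseteq> carrier G" "\<And>b. b \<in> B \<Longrightarrow> inv b \<in> B" "x \<in> generate G B"
  shows "\<exists>l\<in>lists B. x = word_prod l"
  using assms(3)
proof (induction rule: generate.induct)
  case one
  show ?case by (intro bexI[of _ "[]"]) auto
next
  case (incl h)
  then show ?case using assms by (intro bexI[of _ "[h]"]) auto
next
  case (inv h)
  then show ?case using assms by (intro bexI[of _ "[inv h]"]) auto
next
  case (eng h1 h2)
  then obtain l1 l2 where l: "l1 \<in> lists B" "l2 \<in> lists B" "h1 = word_prod l1" "h2 = word_prod l2"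
    by blast
  then have "set l1 \<subseteq> carrier G" "set l2 \<subseteq> carrier G"
    using assms(1) by auto
  with l show ?case
    by (intro bexI[of _ "l1 @ l2"]) (auto simp: word_prod_append)
qed

text \<open>Each arc is right multiplication by an element of \<open>S\<close> or its inverse;
  spelling these in \<open>B\<close> trades \<open>S\<close> for a more convenient set at the cost
  of a factor \<open>c\<close>.\<close>

lemma awalk_imp_word_prod:
  assumes S: "S \<subseteq> carrier G"
    and B: "B \<subseteq> carrier G"
    and word: "\<And>s. s \<in> S \<Longrightarrow> \<exists>l\<in>lists B. length l \<le> c \<and> s = word_prod l"
    and word_inv: "\<And>s. s \<in> S \<Longrightarrow> \<exists>l\<in>lists B. length l \<le> c \<and> inv s = word_prod l"
    and "pre_digraph.awalk (cayley_graph G S) g p h"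
  shows "\<exists>l\<in>lists B. length l \<le> c * length p \<and> h = g \<otimes> word_prod l"
  using assms(5)
proof (induction p arbitrary: g)
  interpret X: wf_digraph "cayley_graph G S" by (rule wf_digraph_cayley_graph)
  {
    case Nil
    then show ?case
      by (intro bexI[of _ "[]"]) (auto simp: X.awalk_Nil_iff cayley_graph_simps)
  next
    case (Cons e p)
    define g' where "g' = snd e"
    from Cons.prems have e: "e \<in> arcs (cayley_graph G S)" "g = fst e" "X.awalk g' p h"
      by (auto simp: X.awalk_Cons_iff cayley_graph_simps g'_def)
    obtain l where l: "l \<in> lists B" "length l \<le> c * length p" "h = g' \<otimes> word_prod l"
      using Cons.IH[OF e(3)] by blast
    obtain s where s: "s \<in> S" "g' = g \<otimes> s \<or> g = g' \<otimes> s" and gg: "g \<in> carrier G" "g' \<in> carrier G"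
      using e by (auto simp: cayley_graph_simps g'_def)
    have sc: "s \<in> carrier G" using s S by blast
    have "\<exists>l'\<in>lists B. length l' \<le> c \<and> g' = g \<otimes> word_prod l'"
      using s(2)
    proof
      assume "g' = g \<otimes> s"
      with word[OF s(1)] show ?thesis by blast
    next
      assume "g = g' \<otimes> s"
      then have "g' = g \<otimes> inv s"
        using gg sc by (simp add: m_assoc)
      with word_inv[OF s(1)] show ?thesis by auto
    qed
    then obtain l' where l': "l' \<in> lists B" "length l' \<le> c" "g' = g \<otimes> word_prod l'" by blast
    have "set l \<subseteq> carrier G" "set l' \<subseteq> carrier G"
      using l(1) l'(1) B by auto
    then have "h = g \<otimes> word_prod (l' @ l)"
      using l(3) l'(3) gg by (simp add: word_prod_append m_assoc)
    with l l' show ?case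
      by (intro bexI[of _ "l' @ l"]) auto
  }
qed

end

lemma finite_uniform_bound:
  assumes "finite A" "\<And>a. a \<in> A \<Longrightarrow> \<exists>n::nat. P a n" "\<And>a m n. P a m \<Longrightarrow> m \<le> n \<Longrightarrow> P a n"
  shows "\<exists>n. \<forall>a\<in>A. P a n"
proof -
  obtain f where f: "\<And>a. a \<in> A \<Longrightarrow> P a (f a)"
    using assms(2) by metis
  show ?thesis
    using assms(1,3) f by (intro exI[of _ "Max (f ` A)"] ballI) (meson Max_ge finite_imageI imageI)
qed

text \<open>This frees the argument from the given \<open>S\<close> and \<open>T\<close>:
  multiplication by an element of \<open>A\<close> is a bounded walk over \<open>S\<close>, the
  Lipschitz bound keeps the images of its ends close over \<open>T\<close>, and the letters of
  \<open>T\<close> are spelled in \<open>B\<close>.\<close>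

lemma regular_map_imp_words:
  assumes "group G" "group G'"
    and S: "finite_generating_set G S" and T: "finite_generating_set G' T"
    and reg: "regular_map (cayley_graph G S) (cayley_graph G' T) \<phi>"
    and A: "finite A" "A \<subseteq> carrier G"
    and B: "B \<subseteq> carrier G'" "generate G' B = carrier G'" "\<And>b. b \<in> B \<Longrightarrow> inv\<^bsub>G'\<^esub> b \<in> B"
  shows "\<exists>K. \<forall>g\<in>carrier G. \<forall>a\<in>A. \<exists>l\<in>lists B. length l \<le> K \<and>
           \<phi> (g \<otimes>\<^bsub>G\<^esub> a) = \<phi> g \<otimes>\<^bsub>G'\<^esub> group.word_prod G' l"
proof -
  interpret G: group G by fact
  interpret G': group G' by fact
  let ?X = "cayley_graph G S" and ?Y = "cayley_graph G' T"
  have wf: "wf_digraph ?X" "wf_digraph ?Y"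
    by (rule wf_digraph_cayley_graph)+
  from S have S': "S \<subseteq> carrier G" "generate G S = carrier G"
    by (auto simp: finite_generating_set_def)
  from T have T': "finite T" "T \<subseteq> carrier G'"
    by (auto simp: finite_generating_set_def)
  obtain n where n: "\<And>a g. a \<in> A \<Longrightarrow> g \<in> carrier G \<Longrightarrow>
      \<exists>p. pre_digraph.awalk ?X g p (g \<otimes>\<^bsub>G\<^esub> a) \<and> length p \<le> n"
  proof -
    have "\<exists>n. \<forall>a\<in>A. \<forall>g\<in>carrier G. \<exists>p. pre_digraph.awalk ?X g p (g \<otimes>\<^bsub>G\<^esub> a) \<and> length p \<le> n"
    proof (rule finite_uniform_bound[OF A(1)])
      fix a assume "a \<in> A"
      with A(2) S' have "a \<in> generate G S" by blast
      then show "\<exists>n. \<forall>g\<in>carrier G. \<exists>p. pre_digraph.awalk ?X g p (g \<otimes>\<^bsub>G\<^esub> a) \<and> length p \<le> n"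
        by (rule G.awalk_mult_generate[OF S'(1)])
    qed (meson order.trans)
    then show ?thesis using that by blast
  qed
  have "\<exists>c. \<forall>x\<in>T \<union> m_inv G' ` T. \<exists>l\<in>lists B. length l \<le> c \<and> x = G'.word_prod l"
  proof (rule finite_uniform_bound)
    fix x assume "x \<in> T \<union> m_inv G' ` T"
    with T' B(2) have "x \<in> generate G' B" by auto
    from G'.generate_imp_word_prod[OF B(1) B(3) this]
    show "\<exists>n. \<exists>l\<in>lists B. length l \<le> n \<and> x = G'.word_prod l" by blast
  qed (use T'(1) in \<open>auto intro: order.trans\<close>)
  then obtain c where c: "\<And>x. x \<in> T \<union> m_inv G' ` T \<Longrightarrow> \<exists>l\<in>lists B. length l \<le> c \<and> x = G'.word_prod l"
    by blast
  obtain K where K: "K > 0" "\<And>x y. x \<in> carrier G \<Longrightarrow> y \<in> carrier G \<Longrightarrow>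
      graph_dist ?Y (\<phi> x) (\<phi> y) \<le> ereal K * graph_dist ?X x y"
    using reg by (auto simp: regular_map_def cayley_graph_simps)
  \<comment> \<open>Rounding up turns the real bound into a number of arcs.\<close>
  define m where "m = nat \<lceil>K * n\<rceil>"
  show ?thesis
  proof (intro exI[of _ "c * m"] ballI)
    fix g a assume ga: "g \<in> carrier G" "a \<in> A"
    then have ga': "g \<otimes>\<^bsub>G\<^esub> a \<in> carrier G" using A(2) by auto
    obtain p where p: "pre_digraph.awalk ?X g p (g \<otimes>\<^bsub>G\<^esub> a)" "length p \<le> n"
      using n ga by blast
    have "graph_dist ?Y (\<phi> g) (\<phi> (g \<otimes>\<^bsub>G\<^esub> a)) \<le> ereal K * graph_dist ?X g (g \<otimes>\<^bsub>G\<^esub> a)"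
      using K(2) ga(1) ga' .
    also have "\<dots> \<le> ereal K * ereal (real (length p))"
      using K(1) awalk_imp_graph_dist_le[OF wf(1) p(1)] by (intro ereal_mult_left_mono) auto
    also have "\<dots> \<le> ereal (real m)"
    proof -
      have "K * length p \<le> K * n"
        using K(1) p(2) by simp
      also have "\<dots> \<le> m"
        unfolding m_def by (rule real_nat_ceiling_ge)
      finally show ?thesis by simp
    qed
    finally obtain q where q: "pre_digraph.awalk ?Y (\<phi> g) q (\<phi> (g \<otimes>\<^bsub>G\<^esub> a))" "length q \<le> m"
      using graph_dist_le_imp_awalk[OF wf(2)] by blast
    have "\<exists>l\<in>lists B. length l \<le> c * length q \<and> \<phi> (g \<otimes>\<^bsub>G\<^esub> a) = \<phi> g \<otimes>\<^bsub>G'\<^esub> G'.word_prod l"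
      by (rule G'.awalk_imp_word_prod[OF T'(2) B(1) _ _ q(1)]) (use c in \<open>auto simp del: in_lists_conv_set\<close>)
    moreover have "c * length q \<le> c * m"
      using q(2) by simp
    ultimately show "\<exists>l\<in>lists B. length l \<le> c * m \<and> \<phi> (g \<otimes>\<^bsub>G\<^esub> a) = \<phi> g \<otimes>\<^bsub>G'\<^esub> G'.word_prod l"
      by (meson order.trans)
  qed
qed

section \<open>The groups\<close>

text \<open>
  An \<open>i\<close>-Lipschitz map moves points of \<open>Q\<close> that are joined by an edge to points at distance at
  most \<open>reach i\<close>, since the generators of \<open>Q\<close> are words of length at most \<open>4 * spacing i + 1\<close>.
\<close>

primrec spacing :: "nat \<Rightarrow> nat" where
  "spacing 0 = 1"
| "spacing (Suc i) = Suc (12 * (i * (4 * spacing i + 1))) + spacing i"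

definition reach :: "nat \<Rightarrow> nat" where
  "reach i = i * (4 * spacing i + 1)"

lemma spacing_mono: "i \<le> j \<Longrightarrow> spacing i \<le> spacing j"
  by (rule lift_Suc_mono_le[of spacing]) auto

text \<open>The margin \<open>12 * reach i\<close> is the diameter of the window of offsets in
  \<open>lamp_index i\<close>; for \<open>j > i\<close> the multiples of \<open>spacing j\<close>
  are further apart than that.\<close>

lemma spacing_less: "i < j \<Longrightarrow> 12 * reach i + spacing i < spacing j"
  using spacing_mono[of "Suc i" j] by (simp add: reach_def)

lemma spacing_inj: "spacing i = spacing j \<longleftrightarrow> i = j"
  using spacing_less[of i j] spacing_less[of j i] by (metis add_lessD1 add.commute less_irrefl nat_neq_iff)

section \<open>Shifts, lamps and words in them\<close>

type_synonym point = "int \<times> nat \<times> nat list"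

definition shift :: "int \<Rightarrow> point \<Rightarrow> point" where
  "shift m = (\<lambda>(p, j, w). (p + m, j, w))"

text \<open>The conjugate by \<open>shift m\<close> of the \<open>k\<close>-th generating involution.\<close>

definition lamp :: "(nat \<Rightarrow> nat) \<Rightarrow> nat set \<Rightarrow> int \<Rightarrow> nat \<Rightarrow> point \<Rightarrow> point" where
  "lamp g X m k = (\<lambda>(p, j, w).
     (p, j, if j \<in> X \<and> p = int (k * spacing j) + m then toggle (g j) k w else w))"

definition lamp_gens :: "(nat \<Rightarrow> nat) \<Rightarrow> nat set \<Rightarrow> (point \<Rightarrow> point) set" where
  "lamp_gens g X = {shift 1, shift (-1)} \<union> lamp g X 0 ` {..<3}"

text \<open>The generators are closed under inverses, so words without formal inverses already form
  a group.\<close>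

definition lamp_elems :: "(nat \<Rightarrow> nat) \<Rightarrow> nat set \<Rightarrow> (point \<Rightarrow> point) set" where
  "lamp_elems g X = comp_list ` lists (lamp_gens g X)"

lemma shift_0: "shift 0 = id"
  by (auto simp: shift_def)

lemma shift_comp: "shift m \<circ> shift n = shift (m + n)"
  by (auto simp: shift_def)

lemma lamp_lamp: "lamp g X m k (lamp g X m k x) = x"
  by (cases x) (simp add: lamp_def toggle_toggle)

lemma lamp_comp_lamp: "lamp g X m k \<circ> lamp g X m k = id"
  by (simp add: fun_eq_iff lamp_lamp)

text \<open>This moves shifts to the right past lamps, at the cost of a new offset of the
  lamp.\<close>

lemma shift_comp_lamp: "shift n \<circ> lamp g X m k = lamp g X (n + m) k \<circ> shift n"
  by (auto simp: shift_def lamp_def fun_eq_iff algebra_simps)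

lemma fst_shift: "fst (shift m x) = fst x + m"
  by (cases x) (simp add: shift_def)

lemma fst_lamp: "fst (lamp g X m k x) = fst x"
  by (cases x) (simp add: lamp_def)

lemma shift_iterate: "comp_list (replicate n (shift m)) = shift (int n * m)"
  by (induction n) (simp_all add: shift_0 shift_comp algebra_simps)

lemma lamp_elems_comp:
  assumes "f \<in> lamp_elems g X" "h \<in> lamp_elems g X"
  shows "f \<circ> h \<in> lamp_elems g X"
proof -
  obtain l l' where l: "l \<in> lists (lamp_gens g X)" "l' \<in> lists (lamp_gens g X)"
    "f = comp_list l" "h = comp_list l'"
    using assms by (auto simp: lamp_elems_def)
  then have "comp_list (l @ l') \<in> lamp_elems g X"
    unfolding lamp_elems_def by (intro imageI) simp
  then show ?thesis by (simp add: l)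
qed

lemma lamp_elems_id: "id \<in> lamp_elems g X"
  unfolding lamp_elems_def by (intro image_eqI[of _ _ "[]"]) auto

lemma lamp_elems_gens: "u \<in> lamp_gens g X \<Longrightarrow> u \<in> lamp_elems g X"
  unfolding lamp_elems_def by (intro image_eqI[of _ _ "[u]"]) auto

lemma lamp_elems_words: "l \<in> lists (lamp_gens g X) \<Longrightarrow> comp_list l \<in> lamp_elems g X"
  unfolding lamp_elems_def by blast

lemma lamp_gens_inverse:
  assumes "u \<in> lamp_gens g X"
  shows "\<exists>v\<in>lamp_gens g X. u \<circ> v = id \<and> v \<circ> u = id"
proof -
  consider "u = shift 1" | "u = shift (-1)" | k where "k < 3" "u = lamp g X 0 k"
    using assms by (auto simp: lamp_gens_def)
  then show ?thesis
  proof cases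
    case 3
    then show ?thesis
      by (intro bexI[of _ u]) (auto simp: lamp_gens_def lamp_comp_lamp)
  qed (auto simp: lamp_gens_def shift_comp shift_0)
qed

lemma lamp_elems_inverse:
  assumes "f \<in> lamp_elems g X"
  shows "\<exists>h\<in>lamp_elems g X. f \<circ> h = id \<and> h \<circ> f = id"
proof -
  obtain l where l: "l \<in> lists (lamp_gens g X)" "f = comp_list l"
    using assms by (auto simp: lamp_elems_def)
  have "\<exists>h\<in>lamp_elems g X. comp_list l \<circ> h = id \<and> h \<circ> comp_list l = id"
    using l(1)
  proof (induction l)
    case Nil
    show ?case using lamp_elems_id by (intro bexI[of _ id]) auto
  next
    case (Cons u l)
    then obtain h where h: "h \<in> lamp_elems g X" "comp_list l \<circ> h = id" "h \<circ> comp_list l = id"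
      by blast
    obtain v where v: "v \<in> lamp_gens g X" "u \<circ> v = id" "v \<circ> u = id"
      using Cons.hyps lamp_gens_inverse by blast
    have "(u \<circ> comp_list l) \<circ> (h \<circ> v) = u \<circ> (comp_list l \<circ> h) \<circ> v"
      and "(h \<circ> v) \<circ> (u \<circ> comp_list l) = h \<circ> (v \<circ> u) \<circ> comp_list l"
      by (simp_all add: o_assoc)
    then have "comp_list (u # l) \<circ> (h \<circ> v) = id" "(h \<circ> v) \<circ> comp_list (u # l) = id"
      using h v by simp_all
    then show ?case
      using lamp_elems_comp[OF h(1) lamp_elems_gens[OF v(1)]] by blast
  qed
  then show ?thesis using l(2) by simp
qed

lemma lamp_elems_inj: "f \<in> lamp_elems g X \<Longrightarrow> inj f"
  using lamp_elems_inverse[of f g X] by (metis inj_on_id inj_on_imageI2)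

text \<open>The homomorphism to the integers that kills the lamps, read off at one point; by
  \<open>fst_lamp_elems\<close> every point gives the same value.\<close>

definition displacement :: "(point \<Rightarrow> point) \<Rightarrow> int" where
  "displacement f = fst (f (0, 0, []))"

lemma fst_lamp_elems:
  assumes "f \<in> lamp_elems g X"
  shows "fst (f x) = fst x + displacement f"
proof -
  obtain l where l: "l \<in> lists (lamp_gens g X)" "f = comp_list l"
    using assms by (auto simp: lamp_elems_def)
  have "\<exists>m. \<forall>x. fst (comp_list l x) = fst x + m"
    using l(1)
  proof (induction l)
    case (Cons u l)
    then obtain m where "\<And>x. fst (comp_list l x) = fst x + m" by blast
    moreover have "\<exists>n. \<forall>x. fst (u x) = fst x + n"
      using Cons.hyps by (auto simp: lamp_gens_def fst_shift fst_lamp intro: exI[of _ 0])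
    then obtain n where "\<And>x. fst (u x) = fst x + n" by blast
    ultimately show ?case
      by (intro exI[of _ "m + n"]) simp
  qed (auto intro: exI[of _ 0])
  then obtain m where m: "\<And>x. fst (f x) = fst x + m"
    using l(2) by blast
  show ?thesis
    using m[of "(0, 0, [])"] m[of x] by (simp add: displacement_def)
qed

section \<open>Products of lamps in a window\<close>

definition lamp_index :: "nat \<Rightarrow> (int \<times> nat) set" where
  "lamp_index i = {- int (6 * reach i)..int (6 * reach i)} \<times> {..<3}"

text \<open>Contains every point of a tree \<open>j < i\<close> that a lamp of
  \<open>lamp_index i\<close> can move, since \<open>k \<le> 2\<close> and
  \<open>spacing j \<le> spacing i\<close>. Only values of \<open>g\<close> below \<open>i\<close>
  enter, so \<open>g\<close> can be chosen recursively.\<close>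

definition near_points :: "(nat \<Rightarrow> nat) \<Rightarrow> nat \<Rightarrow> point set" where
  "near_points g i =
     {- int (6 * reach i)..int (2 * spacing i + 6 * reach i)} \<times> (SIGMA j:{..<i}. reduced_words (g j))"

definition lamp_bound :: "(nat \<Rightarrow> nat) \<Rightarrow> nat \<Rightarrow> nat" where
  "lamp_bound g i =
     card (near_points g i) ^ card (near_points g i) * 2 ^ card (lamp_index i)"

definition lamp_prods :: "(nat \<Rightarrow> nat) \<Rightarrow> nat set \<Rightarrow> nat \<Rightarrow> (point \<Rightarrow> point) set" where
  "lamp_prods g X i = comp_list ` map (\<lambda>(m, k). lamp g X m k) ` lists (lamp_index i)"

lemma lamp_eq_self:
  "\<not> (j \<in> X \<and> p = int (k * spacing j) + m \<and> k < 3 \<and> w \<in> reduced_words (g j)) \<Longrightarrow>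
     lamp g X m k (p, j, w) = (p, j, w)"
  by (auto simp: lamp_def toggle_def)

lemma lamp_bound_cong: "(\<And>j. j < i \<Longrightarrow> g j = h j) \<Longrightarrow> lamp_bound g i = lamp_bound h i"
proof -
  assume "\<And>j. j < i \<Longrightarrow> g j = h j"
  then have "near_points g i = near_points h i"
    unfolding near_points_def by (intro Sigma_cong) auto
  then show ?thesis by (simp add: lamp_bound_def)
qed

text \<open>Distinct multiples of \<open>s\<close> are at least \<open>s\<close> apart, more than
  two offsets bounded by \<open>d\<close> can bridge.\<close>

lemma mult_diff_bounded:
  fixes a b :: nat and s m n d :: int
  assumes "int a * s + m = int b * s + n" "\<bar>m\<bar> \<le> d" "\<bar>n\<bar> \<le> d" "2 * d < s"
  shows "a = b"
proof (rule ccontr)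
  assume "a \<noteq> b"
  then have "1 \<le> \<bar>int a - int b\<bar>" by simp
  moreover have "0 \<le> s" using assms by linarith
  ultimately have "1 * s \<le> \<bar>int a - int b\<bar> * s" by (intro mult_right_mono)
  also have "\<dots> = \<bar>(int a - int b) * s\<bar>"
    using \<open>0 \<le> s\<close> by (simp add: abs_mult)
  also have "(int a - int b) * s = n - m"
    using assms(1) by (simp add: algebra_simps)
  also have "\<bar>n - m\<bar> \<le> 2 * d" using assms by linarith
  finally show False using assms by linarith
qed

text \<open>Outside of \<open>near_points g i\<close> at most one lamp of the window moves a given
  point, so \<open>card_products_le\<close> applies: tree \<open>i\<close> is at rest since
  \<open>i \<notin> X\<close>, and in a tree \<open>j > i\<close> the position determines
  \<open>k\<close> by the large spacing, and then \<open>m\<close>.\<close>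

lemma lamp_prods_bound:
  assumes "i \<notin> X"
  shows "finite (lamp_prods g X i)" "card (lamp_prods g X i) \<le> lamp_bound g i"
proof -
  let ?z = "\<lambda>(m, k). lamp g X m k"
  let ?D = "int (6 * reach i)"
  have fin: "finite (lamp_index i)" "finite (near_points g i)"
    by (auto simp: lamp_index_def near_points_def finite_reduced_words)
  have inv: "?z a x \<in> near_points g i" if "a \<in> lamp_index i" "x \<in> near_points g i" for a x
    using that by (cases a; cases x) (auto simp: near_points_def lamp_def toggle_in_reduced_words)
  have out: "\<exists>a. ?z a (?z a x) = x \<and> (\<forall>b\<in>lamp_index i. b \<noteq> a \<longrightarrow> ?z b x = x \<and> ?z b (?z a x) = ?z a x)"
    if x: "x \<notin> near_points g i" for x
  proof -
    obtain p j w where xp: "x = (p, j, w)" by (cases x)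
    show ?thesis
    proof (cases "i < j \<and> (\<exists>m k. (m, k) \<in> lamp_index i \<and> p = int (k * spacing j) + m)")
      case True
      then obtain m k where mk: "i < j" "(m, k) \<in> lamp_index i" "p = int (k * spacing j) + m"
        by blast
      have "lamp g X n l (p, j, v) = (p, j, v)" if "(n, l) \<in> lamp_index i" "(n, l) \<noteq> (m, k)" for n l v
      proof (rule lamp_eq_self, safe)
        assume p: "p = int (l * spacing j) + n"
        have "l = k"
        proof (rule mult_diff_bounded)
          show "int l * int (spacing j) + n = int k * int (spacing j) + m"
            using p mk(3) by simp
          show "\<bar>n\<bar> \<le> ?D" "\<bar>m\<bar> \<le> ?D"
            using that(1) mk(2) by (auto simp: lamp_index_def)
          show "2 * ?D < int (spacing j)"
            using spacing_less[OF mk(1)] by linarith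
        qed
        with that(2) p mk(3) show False by simp
      qed
      moreover have "\<exists>v. ?z (m, k) x = (p, j, v)"
        by (auto simp: xp lamp_def)
      ultimately have "?z b x = x \<and> ?z b (?z (m, k) x) = ?z (m, k) x"
        if "b \<in> lamp_index i" "b \<noteq> (m, k)" for b
        using that unfolding xp by (metis (no_types, lifting) case_prod_conv surj_pair)
      then show ?thesis
        by (intro exI[of _ "(m, k)"]) (simp add: lamp_lamp)
    next
      case False
      have "lamp g X m k x = x" if "(m, k) \<in> lamp_index i" for m k
        unfolding xp
      proof (rule lamp_eq_self, safe)
        assume *: "j \<in> X" "p = int (k * spacing j) + m" "k < 3" "w \<in> reduced_words (g j)"
        then have "j < i"
          using False that assms by (metis linorder_neqE_nat)
        have "int (k * spacing j) \<le> int (2 * spacing i)"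
          using *(3) spacing_mono[of j i] \<open>j < i\<close> by (intro iffD2[OF of_nat_le_iff] mult_le_mono) auto
        moreover have "\<bar>m\<bar> \<le> ?D"
          using that by (auto simp: lamp_index_def)
        ultimately have "- ?D \<le> p" "p \<le> int (2 * spacing i + 6 * reach i)"
          unfolding *(2) by linarith+
        then have "x \<in> near_points g i"
          unfolding xp near_points_def using \<open>j < i\<close> *(4) by (intro SigmaI) auto
        with x show False by contradiction
      qed
      \<comment> \<open>There is no colour 3, so this lamp is the identity and \<open>(0, 3)\<close>
        serves as the index for a point that no lamp of the window moves.\<close>
      moreover have "lamp g X 0 3 x = x"
        unfolding xp by (rule lamp_eq_self) simp
      ultimately have "?z b x = x \<and> ?z b (?z (0, 3) x) = ?z (0, 3) x" if "b \<in> lamp_index i" for b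
        using that by (cases b) simp
      then show ?thesis
        by (intro exI[of _ "(0, 3)"]) (simp add: lamp_lamp)
    qed
  qed
  show "finite (lamp_prods g X i)"
    unfolding lamp_prods_def by (rule card_products_le(1)[OF fin inv out])
  show "card (lamp_prods g X i) \<le> lamp_bound g i"
    unfolding lamp_prods_def lamp_bound_def by (rule card_products_le(2)[OF fin inv out])
qed

lemma lamp_prods_id: "id \<in> lamp_prods g X i"
proof -
  have "comp_list (map (\<lambda>(m, k). lamp g X m k) []) \<in> lamp_prods g X i"
    unfolding lamp_prods_def by (intro imageI) simp
  then show ?thesis by simp
qed

lemma lamp_prods_snoc:
  assumes "u \<in> lamp_prods g X i" "(m, k) \<in> lamp_index i"
  shows "u \<circ> lamp g X m k \<in> lamp_prods g X i"
proof -
  obtain l where l: "l \<in> lists (lamp_index i)" "u = comp_list (map (\<lambda>(m, k). lamp g X m k) l)"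
    using assms(1) by (auto simp: lamp_prods_def)
  have "comp_list (map (\<lambda>(m, k). lamp g X m k) (l @ [(m, k)])) \<in> lamp_prods g X i"
    unfolding lamp_prods_def using l(1) assms(2) by (intro imageI) simp
  then show ?thesis by (simp add: l(2))
qed

lemma fst_lamp_prods: "u \<in> lamp_prods g X i \<Longrightarrow> fst (u x) = fst x"
proof -
  have "fst (comp_list (map (\<lambda>(m, k). lamp g X m k) l) x) = fst x" for l
    by (induction l) (auto simp: fst_lamp)
  then show "u \<in> lamp_prods g X i \<Longrightarrow> fst (u x) = fst x"
    by (auto simp: lamp_prods_def)
qed

text \<open>Reading the word from the left, a shift changes the offset \<open>n\<close>, and a lamp
  is pulled across \<open>shift n\<close>, which gives it offset \<open>n\<close>. The length bound
  keeps these offsets in the window.\<close>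

lemma lamp_prods_absorb:
  assumes "u \<in> lamp_prods g X i" "l \<in> lists (lamp_gens g X)"
    and "\<bar>n\<bar> + int (length l) \<le> int (6 * reach i)"
  shows "\<exists>u'\<in>lamp_prods g X i. \<exists>n'. \<bar>n' - n\<bar> \<le> int (length l) \<and>
           u \<circ> shift n \<circ> comp_list l = u' \<circ> shift n'"
  using assms(2,1,3)
proof (induction l arbitrary: u n)
  case Nil
  then show ?case by (intro bexI[of _ u] exI[of _ n]) auto
next
  case (Cons f l)
  have "\<exists>v\<in>lamp_prods g X i. \<exists>d. \<bar>d\<bar> \<le> 1 \<and> u \<circ> shift n \<circ> f = v \<circ> shift (n + d)"
  proof -
    consider d where "\<bar>d\<bar> \<le> 1" "f = shift d" | k where "k < 3" "f = lamp g X 0 k"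
      using Cons.hyps(1) unfolding lamp_gens_def by force
    then show ?thesis
    proof cases
      case 1
      then show ?thesis
        using Cons.prems(1) by (intro bexI[of _ u] exI[of _ d]) (auto simp: comp_assoc shift_comp)
    next
      case 2
      have "u \<circ> shift n \<circ> f = (u \<circ> lamp g X n k) \<circ> shift n"
        by (simp add: 2 comp_assoc shift_comp_lamp)
      moreover have "u \<circ> lamp g X n k \<in> lamp_prods g X i"
        using Cons.prems 2 by (intro lamp_prods_snoc) (auto simp: lamp_index_def)
      ultimately show ?thesis
        by (intro bexI[of _ "u \<circ> lamp g X n k"] exI[of _ 0]) auto
    qed
  qed
  then obtain v d where v: "v \<in> lamp_prods g X i" "\<bar>d\<bar> \<le> 1" "u \<circ> shift n \<circ> f = v \<circ> shift (n + d)"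
    by blast
  have "\<bar>n + d\<bar> + int (length l) \<le> int (6 * reach i)"
    using Cons.prems(2) v(2) by simp
  from Cons.IH[OF v(1) this] obtain u' n' where *: "u' \<in> lamp_prods g X i"
    "\<bar>n' - (n + d)\<bar> \<le> int (length l)" "v \<circ> shift (n + d) \<circ> comp_list l = u' \<circ> shift n'"
    by blast
  have "u \<circ> shift n \<circ> comp_list (f # l) = (u \<circ> shift n \<circ> f) \<circ> comp_list l"
    by (simp add: o_assoc)
  also have "\<dots> = u' \<circ> shift n'"
    using *(3) v(3) by simp
  finally have "u \<circ> shift n \<circ> comp_list (f # l) = u' \<circ> shift n'" .
  moreover have "\<bar>n' - n\<bar> \<le> int (length (f # l))"
    using *(2) v(2) by simp
  ultimately show ?case
    using *(1) by blast
qed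

section \<open>Groups without regular maps between them\<close>

lemma div_eq_of_gap:
  fixes x y r M :: int
  assumes "0 < M" "\<bar>x - y\<bar> \<le> r" "r \<le> x mod M" "r \<le> y mod M"
  shows "x div M = y div M"
proof -
  \<comment> \<open>The lowest \<open>r\<close> residues of each block form a gap; a step from an
    earlier block to a point \<open>b\<close> above the gap is longer than \<open>r\<close>.\<close>
  have *: "\<not> a div M < b div M" if "b - a \<le> r" "r \<le> b mod M" for a b
  proof
    assume "a div M < b div M"
    then have "M * (a div M + 1) \<le> M * (b div M)"
      using assms(1) by (intro mult_left_mono) auto
    moreover have "a mod M < M" using assms(1) by simp
    moreover have "a = M * (a div M) + a mod M" "b = M * (b div M) + b mod M" by simp_all
    ultimately show False
      using that by (simp add: algebra_simps)
  qed
  show ?thesis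
    using *[of y x] *[of x y] assms by linarith
qed

lemma div_eq_imp_abs_diff_less:
  fixes x y M :: int
  assumes "0 < M" "x div M = y div M"
  shows "\<bar>x - y\<bar> < M"
proof -
  have "x = M * (x div M) + x mod M" "y = M * (y div M) + y mod M"
    by simp_all
  then have "x - y = x mod M - y mod M"
    using assms(2) by (metis add_diff_cancel_left)
  moreover have "0 \<le> x mod M" "x mod M < M" "0 \<le> y mod M" "y mod M < M"
    using assms(1) by simp_all
  ultimately show ?thesis by linarith
qed

lemma card_eq_sum_of_bool: "finite A \<Longrightarrow> card {x \<in> A. P x} = (\<Sum>x\<in>A. of_bool (P x))"
  by (simp add: Int_def)

text \<open>Averaging over \<open>c\<close>: a given \<open>t q\<close> falls into the translated
  gap for at most \<open>r\<close> of the \<open>M\<close> residues \<open>c\<close>.\<close>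

lemma exists_sparse_residue:
  fixes t :: "'a \<Rightarrow> int" and r M :: nat
  assumes "finite Q" "0 < M"
  shows "\<exists>c. M * card {q \<in> Q. (t q - c) mod int M < int r} \<le> r * card Q"
proof (rule ccontr)
  assume "\<not> ?thesis"
  then have less: "r * card Q < M * card {q \<in> Q. (t q - c) mod int M < int r}" for c
    using not_le by blast
  have "M * (r * card Q) = (\<Sum>c\<in>{0..<int M}. r * card Q)"
    by simp
  also have "\<dots> < (\<Sum>c\<in>{0..<int M}. M * card {q \<in> Q. (t q - c) mod int M < int r})"
    using less assms(2) by (intro sum_strict_mono) auto
  also have "\<dots> = M * (\<Sum>c\<in>{0..<int M}. \<Sum>q\<in>Q. of_bool ((t q - c) mod int M < int r))"
    by (simp only: sum_distrib_left card_eq_sum_of_bool[OF assms(1)])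
  also have "(\<Sum>c\<in>{0..<int M}. \<Sum>q\<in>Q. of_bool ((t q - c) mod int M < int r)) =
               (\<Sum>q\<in>Q. card {c \<in> {0..<int M}. (t q - c) mod int M < int r})"
    by (subst sum.swap) (simp only: card_eq_sum_of_bool[OF finite_atLeastLessThan_int])
  also have "\<dots> \<le> (\<Sum>q\<in>Q. r)"
  proof (rule sum_mono)
    fix q
    have "card {c \<in> {0..<int M}. (t q - c) mod int M < int r} \<le> card {0..<int r}"
    proof (rule card_inj_on_le)
      show "inj_on (\<lambda>c. (t q - c) mod int M) {c \<in> {0..<int M}. (t q - c) mod int M < int r}"
      proof (rule inj_onI)
        fix c d
        assume c: "c \<in> {c \<in> {0..<int M}. (t q - c) mod int M < int r}"
          and d: "d \<in> {c \<in> {0..<int M}. (t q - c) mod int M < int r}"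
          and "(t q - c) mod int M = (t q - d) mod int M"
        then have "int M dvd (t q - c) - (t q - d)"
          by (simp add: mod_eq_dvd_iff)
        then have "d mod int M = c mod int M"
          by (simp add: mod_eq_dvd_iff)
        then show "c = d" using c d by simp
      qed
    qed (use assms(2) in auto)
    then show "card {c \<in> {0..<int M}. (t q - c) mod int M < int r} \<le> r" by simp
  qed
  finally show False
    by simp
qed

lemma foldl_comp: "foldl (\<lambda>q k. q \<circ> y k) q w = q \<circ> comp_list (map y w)"
  by (induction w arbitrary: q) (simp_all add: o_assoc)

section \<open>The finite subgroup \<open>Q\<close> and its image\<close>

context
  fixes g :: "nat \<Rightarrow> nat" and X :: "nat set" and i :: nat
  assumes iX: "i \<in> X"
begin

text \<open>The offset makes all three colours act on tree \<open>i\<close> at position 0, whereas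
  on a tree \<open>j \<noteq> i\<close> in \<open>X\<close> they act at three different
  positions.\<close>

definition conj_lamp :: "nat \<Rightarrow> point \<Rightarrow> point" where
  "conj_lamp k = lamp g X (- int (k * spacing i)) k"

definition conj_prods :: "(point \<Rightarrow> point) set" where
  "conj_prods = comp_list ` map conj_lamp ` lists {..<3}"

text \<open>Conjugation by a shift of at most \<open>2 * spacing i\<close> adds that many letters on
  each side; this is the source of the constant in \<open>reach\<close>.\<close>

lemma conj_lamp_word:
  assumes "k < 3"
  shows "\<exists>l\<in>lists (lamp_gens g X). length l \<le> 4 * spacing i + 1 \<and> conj_lamp k = comp_list l"
proof -
  define n where "n = k * spacing i"
  let ?l = "replicate n (shift (-1)) @ [lamp g X 0 k] @ replicate n (shift 1)"
  have "comp_list ?l = lamp g X (- int n) k \<circ> (shift (- int n) \<circ> shift (int n))"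
    by (simp add: shift_iterate shift_comp_lamp o_assoc)
  then have "conj_lamp k = comp_list ?l"
    by (simp add: shift_comp shift_0 conj_lamp_def n_def)
  moreover have "n \<le> 2 * spacing i"
    using assms by (auto simp: n_def)
  then have "length ?l \<le> 4 * spacing i + 1"
    by simp
  moreover have "?l \<in> lists (lamp_gens g X)"
    using assms by (auto simp: lamp_gens_def)
  ultimately show ?thesis by blast
qed

text \<open>Tree \<open>i\<close> at position 0 is the exceptional finite set. Elsewhere colour
  \<open>k\<close> acts at \<open>k * (spacing j - spacing i)\<close>, which determines
  \<open>k\<close> because \<open>spacing\<close> is injective.\<close>

lemma finite_conj_prods: "finite conj_prods"
  unfolding conj_prods_def
proof (rule card_products_le(1))
  let ?F = "{0} \<times> {i} \<times> reduced_words (g i)"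
  show "finite ?F" by (simp add: finite_reduced_words)
  show "conj_lamp k x \<in> ?F" if "x \<in> ?F" for k x
    using that by (cases x) (auto simp: conj_lamp_def lamp_def toggle_in_reduced_words)
  show "\<exists>a. conj_lamp a (conj_lamp a x) = x \<and>
      (\<forall>b\<in>{..<3}. b \<noteq> a \<longrightarrow> conj_lamp b x = x \<and> conj_lamp b (conj_lamp a x) = conj_lamp a x)"
    if x: "x \<notin> ?F" for x
  proof -
    obtain p j w where xp: "x = (p, j, w)" by (cases x)
    show ?thesis
    proof (cases "j \<noteq> i \<and> (\<exists>k. p = int (k * spacing j) - int (k * spacing i))")
      case True
      then obtain k where k: "j \<noteq> i" "p = int (k * spacing j) - int (k * spacing i)" by blast
      have fixed: "conj_lamp l (p, j, v) = (p, j, v)" if "l \<noteq> k" for l v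
        unfolding conj_lamp_def
      proof (rule lamp_eq_self, safe)
        assume "p = int (l * spacing j) + - int (l * spacing i)"
        with k(2) have "(int l - int k) * (int (spacing j) - int (spacing i)) = 0"
          by (simp add: algebra_simps)
        with that k(1) show False by (simp add: spacing_inj)
      qed
      have "\<exists>v. conj_lamp k x = (p, j, v)"
        by (auto simp: xp conj_lamp_def lamp_def)
      then have "conj_lamp l x = x \<and> conj_lamp l (conj_lamp k x) = conj_lamp k x" if "l \<noteq> k" for l
        using fixed[OF that] unfolding xp by metis
      then show ?thesis
        by (intro exI[of _ k]) (simp add: conj_lamp_def lamp_lamp)
    next
      case False
      \<comment> \<open>The bound includes the void colour 3, which serves as the index for a point
        at rest.\<close>
      have "conj_lamp k x = x" if "k \<le> 3" for k
        unfolding xp conj_lamp_def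
      proof (rule lamp_eq_self, safe)
        assume *: "p = int (k * spacing j) + - int (k * spacing i)" "w \<in> reduced_words (g j)"
        with False have "j = i" by auto
        with * x show False by (simp add: xp)
      qed
      then show ?thesis
        by (intro exI[of _ 3]) simp
    qed
  qed
qed simp

lemma conj_prods_id: "id \<in> conj_prods"
proof -
  have "comp_list (map conj_lamp []) \<in> conj_prods"
    unfolding conj_prods_def by (intro imageI) simp
  then show ?thesis by simp
qed

lemma conj_prods_snoc:
  assumes "q \<in> conj_prods" "k < 3"
  shows "q \<circ> conj_lamp k \<in> conj_prods"
proof -
  obtain l where l: "l \<in> lists {..<3}" "q = comp_list (map conj_lamp l)"
    using assms(1) by (auto simp: conj_prods_def)
  have "comp_list (map conj_lamp (l @ [k])) \<in> conj_prods"
    unfolding conj_prods_def using l(1) assms(2) by (intro imageI) simp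
  then show ?thesis by (simp add: l(2))
qed

lemma conj_prods_subset: "conj_prods \<subseteq> lamp_elems g X"
proof -
  have "comp_list (map conj_lamp l) \<in> lamp_elems g X" if "l \<in> lists {..<3}" for l
    using that
  proof (induction l)
    case (Cons k l)
    then obtain v where "v \<in> lists (lamp_gens g X)" "conj_lamp k = comp_list v"
      using conj_lamp_word[of k] by blast
    then have "conj_lamp k \<in> lamp_elems g X"
      using lamp_elems_words by metis
    then have "conj_lamp k \<circ> comp_list (map conj_lamp l) \<in> lamp_elems g X"
      using Cons.IH by (rule lamp_elems_comp)
    then show ?case by (simp only: list.map comp_list_simps)
  qed (simp only: list.map comp_list_simps lamp_elems_id)
  then show ?thesis by (auto simp: conj_prods_def simp del: in_lists_conv_set)
qed

text \<open>A reduced word leads from the root to the vertex it names, so reduced words of length at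
  most \<open>g i\<close> give different elements of \<open>Q\<close>.\<close>

lemma conj_lamp_word_origin:
  "w \<in> reduced_words (g i) \<Longrightarrow> comp_list (map conj_lamp w) (0, i, []) = (0, i, w)"
proof (induction w)
  case (Cons k w)
  then have "w \<in> reduced_words (g i)"
    by (auto simp: reduced_words_def distinct_adj_Cons)
  then have "comp_list (map conj_lamp (k # w)) (0, i, []) = conj_lamp k (0, i, w)"
    using Cons.IH by simp
  also have "\<dots> = (0, i, k # w)"
    using iX toggle_Cons[OF Cons.prems] by (simp add: conj_lamp_def lamp_def)
  finally show ?case .
qed simp

lemma displacement_decomp:
  assumes "h \<in> lamp_elems g Y" "u \<in> lamp_prods g Y j"
  shows "displacement (h \<circ> u \<circ> shift n) = displacement h + n"
proof -
  have "displacement (h \<circ> u \<circ> shift n) = fst (u (shift n (0, 0, []))) + displacement h"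
    using fst_lamp_elems[OF assms(1), of "u (shift n (0, 0, []))"]
    by (simp add: displacement_def[of "h \<circ> u \<circ> shift n"])
  then show ?thesis
    by (simp add: fst_lamp_prods[OF assms(2)] fst_shift)
qed

text \<open>The elements sent into gaps form a set \<open>R\<close> of at most a fifth of
  \<open>Q\<close>. A reduced walk of length \<open>g i\<close> avoiding \<open>R\<close> would stay
  over one block, where too few images are available for \<open>g i + 1\<close> different elements
  with fibres of size at most \<open>i\<close>. So \<open>R\<close> meets all these walks and has at
  least a quarter of \<open>Q\<close>.\<close>

lemma no_coarse_map:
  fixes \<psi> :: "(point \<Rightarrow> point) \<Rightarrow> (point \<Rightarrow> point)" and Y :: "nat set"
  assumes iY: "i \<notin> Y" and i: "0 < i"
    and long: "i * (lamp_bound g i * (12 * reach i + 1)) < g i"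
    and maps: "\<And>f. f \<in> lamp_elems g X \<Longrightarrow> \<psi> f \<in> lamp_elems g Y"
    and lip: "\<And>f u. f \<in> lamp_elems g X \<Longrightarrow> u \<in> lamp_gens g X \<Longrightarrow>
       \<exists>l\<in>lists (lamp_gens g Y). length l \<le> i \<and> \<psi> (f \<circ> u) = \<psi> f \<circ> comp_list l"
    and fib: "\<And>h. h \<in> lamp_elems g Y \<Longrightarrow>
       finite {f \<in> lamp_elems g X. \<psi> f = h} \<and> card {f \<in> lamp_elems g X. \<psi> f = h} \<le> i"
  shows False
proof -
  let ?r = "reach i"
  \<comment> \<open>Gaps of length \<open>?r\<close> with this period cost a fifth of
    \<open>Q\<close>, less than the quarter that a separator needs.\<close>
  let ?M = "int (5 * ?r)"
  have r: "0 < ?r" using i by (simp add: reach_def)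
  have lip_word: "\<exists>l'\<in>lists (lamp_gens g Y). length l' \<le> i * length l \<and>
      \<psi> (f \<circ> comp_list l) = \<psi> f \<circ> comp_list l'"
    if "f \<in> lamp_elems g X" "l \<in> lists (lamp_gens g X)" for f l
    using that(2,1)
  proof (induction l arbitrary: f)
    case Nil
    show ?case by (intro bexI[of _ "[]"]) auto
  next
    case (Cons u l)
    obtain l1 where l1: "l1 \<in> lists (lamp_gens g Y)" "length l1 \<le> i" "\<psi> (f \<circ> u) = \<psi> f \<circ> comp_list l1"
      using lip[OF Cons.prems Cons.hyps(1)] by blast
    have "f \<circ> u \<in> lamp_elems g X"
      using Cons.prems lamp_elems_gens[OF Cons.hyps(1)] by (rule lamp_elems_comp)
    from Cons.IH[OF this] obtain l2 where l2: "l2 \<in> lists (lamp_gens g Y)" "length l2 \<le> i * length l"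
      "\<psi> (f \<circ> u \<circ> comp_list l) = \<psi> (f \<circ> u) \<circ> comp_list l2" by blast
    have "\<psi> (f \<circ> comp_list (u # l)) = \<psi> f \<circ> comp_list (l1 @ l2)"
      using l1(3) l2(3) by (simp only: comp_list_simps o_assoc)
    moreover have "length (l1 @ l2) \<le> i * length (u # l)"
      using l1(2) l2(2) by simp
    moreover have "l1 @ l2 \<in> lists (lamp_gens g Y)"
      using l1(1) l2(1) by simp
    ultimately show ?case by blast
  qed
  have lip_conj: "\<exists>l\<in>lists (lamp_gens g Y). length l \<le> ?r \<and> \<psi> (f \<circ> conj_lamp k) = \<psi> f \<circ> comp_list l"
    if f: "f \<in> lamp_elems g X" and k: "k < 3" for f k
  proof -
    obtain l where l: "l \<in> lists (lamp_gens g X)" "length l \<le> 4 * spacing i + 1" "conj_lamp k = comp_list l"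
      using conj_lamp_word[OF k] by blast
    obtain l' where l': "l' \<in> lists (lamp_gens g Y)" "length l' \<le> i * length l"
      "\<psi> (f \<circ> comp_list l) = \<psi> f \<circ> comp_list l'"
      using lip_word[OF f l(1)] by blast
    have "i * length l \<le> ?r"
      unfolding reach_def using l(2) by (intro mult_le_mono2)
    with l' l(3) show ?thesis
      by (intro bexI[of _ l']) simp_all
  qed
  define t where "t = (\<lambda>q. displacement (\<psi> q))"
  obtain c where c: "5 * ?r * card {q \<in> conj_prods. (t q - c) mod ?M < int ?r} \<le> ?r * card conj_prods"
    using exists_sparse_residue[OF finite_conj_prods, of "5 * ?r" t ?r] r by auto
  \<comment> \<open>the gaps have length \<open>reach i\<close>, so no edge of \<open>Q\<close> jumps over them\<close>
  define R where "R = {q \<in> conj_prods. (t q - c) mod ?M < int ?r}"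
  have "?r * (5 * card R) \<le> ?r * card conj_prods"
    using c by (simp add: R_def ac_simps)
  then have sparse: "5 * card R \<le> card conj_prods"
    using r by simp
  have "card conj_prods \<le> 4 * card R"
  proof (rule card_le_separator[where nb = "\<lambda>k q. q \<circ> conj_lamp k" and n = "g i"])
    show "finite conj_prods" by (rule finite_conj_prods)
    show "R \<subseteq> conj_prods" by (auto simp: R_def)
    show "q \<circ> conj_lamp k \<in> conj_prods" if "k < 3" "q \<in> conj_prods" for k q
      using that(2,1) by (rule conj_prods_snoc)
    show "q \<circ> conj_lamp k \<circ> conj_lamp k = q" for k and q :: "point \<Rightarrow> point"
      by (simp add: conj_lamp_def comp_assoc lamp_comp_lamp)
    fix q :: "point \<Rightarrow> point" and w :: "nat list"
    assume w: "distinct_adj w" "set w \<subseteq> {..<3}" "length w = g i"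
    show "\<exists>m\<le>g i. foldl (\<lambda>q k. q \<circ> conj_lamp k) q (take m w) \<notin> conj_prods - R"
    proof (rule ccontr)
      assume contra: "\<not> ?thesis"
      define v where "v = (\<lambda>m. q \<circ> comp_list (map conj_lamp (take m w)))"
      have v: "v m \<in> conj_prods" "v m \<notin> R" if "m \<le> g i" for m
        using contra that by (auto simp: v_def foldl_comp)
      then have vX: "v m \<in> lamp_elems g X" if "m \<le> g i" for m
        using that conj_prods_subset by blast
      have gap: "int ?r \<le> (t (v m) - c) mod ?M" if "m \<le> g i" for m
        using v[OF that] by (simp add: R_def)
      have v0: "v 0 = q" by (simp add: v_def)
      then have qX: "q \<in> lamp_elems g X"
        using vX[of 0] by simp
      note qY = maps[OF qX]
      have v_Suc: "v (Suc m) = v m \<circ> conj_lamp (w ! m)" if "m < g i" for m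
        using that w(3) by (simp add: v_def take_Suc_conv_app_nth o_assoc)
      have walk: "(\<exists>u\<in>lamp_prods g Y i. \<exists>n. \<bar>n\<bar> \<le> ?M \<and> \<psi> (v m) = \<psi> q \<circ> u \<circ> shift n) \<and>
          (t (v m) - c) div ?M = (t q - c) div ?M" if "m \<le> g i" for m
        using that
      proof (induction m)
        case 0
        show ?case
          using lamp_prods_id by (auto simp: v0 shift_0 intro!: bexI[of _ id] exI[of _ 0])
      next
        case (Suc m)
        then obtain u n where u: "u \<in> lamp_prods g Y i" "\<bar>n\<bar> \<le> ?M" "\<psi> (v m) = \<psi> q \<circ> u \<circ> shift n"
          and block: "(t (v m) - c) div ?M = (t q - c) div ?M"
          using Suc_leD by blast
        have "w ! m < 3"
          using w Suc.prems by (metis Suc_le_lessD lessThan_iff nth_mem subsetD)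
        moreover have "v m \<in> lamp_elems g X"
          using vX Suc.prems by simp
        ultimately obtain l where l: "l \<in> lists (lamp_gens g Y)" "length l \<le> ?r"
          "\<psi> (v (Suc m)) = \<psi> (v m) \<circ> comp_list l"
          using lip_conj[of "v m" "w ! m"] v_Suc[of m] Suc.prems by (metis Suc_le_eq)
        \<comment> \<open>An offset of at most \<open>5 * ?r\<close> within a block and the image of
          one edge, of length at most \<open>?r\<close>, explain the radius
          \<open>6 * reach i\<close> of the window.\<close>
        have "\<bar>n\<bar> + int (length l) \<le> int (6 * ?r)"
          using u(2) l(2) by simp
        from lamp_prods_absorb[OF u(1) l(1) this] obtain u' n' where u': "u' \<in> lamp_prods g Y i"
          "\<bar>n' - n\<bar> \<le> int (length l)" "u \<circ> shift n \<circ> comp_list l = u' \<circ> shift n'"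
          by blast
        have eq: "\<psi> (v (Suc m)) = \<psi> q \<circ> u' \<circ> shift n'"
          using l(3) u(3) u'(3) by (simp only: comp_assoc)
        have disp: "t (v m) = t q + n" "t (v (Suc m)) = t q + n'"
          unfolding t_def u(3) eq using u(1) u'(1) by (simp_all add: displacement_decomp[OF qY])
        have "(t (v (Suc m)) - c) div ?M = (t (v m) - c) div ?M"
        proof (rule div_eq_of_gap)
          show "\<bar>t (v (Suc m)) - c - (t (v m) - c)\<bar> \<le> int ?r"
            using u'(2) l(2) by (simp add: disp)
        qed (use r gap Suc.prems in auto)
        with block have block': "(t (v (Suc m)) - c) div ?M = (t q - c) div ?M" by simp
        \<comment> \<open>The bound on the offset is regained from the block, so it does not
          deteriorate along the walk.\<close>
        from div_eq_imp_abs_diff_less[OF _ this] r have "\<bar>n'\<bar> \<le> ?M"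
          by (simp add: disp)
        with u'(1) eq block' show ?case by blast
      qed
      \<comment> \<open>All images of the walk lie in \<open>L\<close>; the intersection with
        \<open>lamp_elems g Y\<close> makes \<open>fib\<close> applicable to its elements.\<close>
      define L where "L = (\<lambda>(u, n). \<psi> q \<circ> u \<circ> shift n) ` (lamp_prods g Y i \<times> {- ?M..?M}) \<inter> lamp_elems g Y"
      have fin: "finite (lamp_prods g Y i \<times> {- ?M..?M})"
        using lamp_prods_bound(1)[OF iY] by simp
      then have finL: "finite L"
        unfolding L_def by (intro finite_Int disjI1 finite_imageI)
      have "card L \<le> card ((\<lambda>(u, n). \<psi> q \<circ> u \<circ> shift n) ` (lamp_prods g Y i \<times> {- ?M..?M}))"
        unfolding L_def using fin by (intro card_mono finite_imageI) auto
      also have "\<dots> \<le> card (lamp_prods g Y i \<times> {- ?M..?M})"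
        using fin by (rule card_image_le)
      also have "\<dots> = card (lamp_prods g Y i) * (10 * ?r + 1)"
        by (simp add: card_cartesian_product nat_add_distrib nat_mult_distrib)
      also have "\<dots> \<le> lamp_bound g i * (12 * ?r + 1)"
        using lamp_prods_bound(2)[OF iY] by (intro mult_le_mono) auto
      finally have cardL: "card L \<le> lamp_bound g i * (12 * ?r + 1)" .
      \<comment> \<open>Prefixes of a reduced word are different vertices of the tree, so the walk
        visits no element twice.\<close>
      have "inj_on v {..g i}"
      proof (rule inj_onI)
        fix m m' assume m: "m \<in> {..g i}" "m' \<in> {..g i}" "v m = v m'"
        have origin: "v m (0, i, []) = q (0, i, take m w)" for m
        proof -
          have "take m w \<in> reduced_words (g i)"
            using w set_take_subset[of m w] distinct_adj_appendD1[of "take m w" "drop m w"]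
            by (auto simp: reduced_words_def)
          from conj_lamp_word_origin[OF this] show ?thesis
            by (simp add: v_def)
        qed
        have "take m w = take m' w"
          using m(3) origin[of m] origin[of m'] lamp_elems_inj[OF qX] by (simp add: inj_eq)
        then have "length (take m w) = length (take m' w)" by simp
        then show "m = m'"
          using m(1,2) w(3) by simp
      qed
      then have "Suc (g i) = card (v ` {..g i})"
        by (simp add: card_image)
      also have "\<dots> \<le> card (\<Union>h\<in>L. {f \<in> lamp_elems g X. \<psi> f = h})"
      proof (rule card_mono)
        show "finite (\<Union>h\<in>L. {f \<in> lamp_elems g X. \<psi> f = h})"
          using finL fib by (intro finite_UN_I) (auto simp: L_def)
        show "v ` {..g i} \<subseteq> (\<Union>h\<in>L. {f \<in> lamp_elems g X. \<psi> f = h})"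
        proof (rule image_subsetI)
          fix m assume m: "m \<in> {..g i}"
          then obtain u n where u: "u \<in> lamp_prods g Y i" "\<bar>n\<bar> \<le> ?M" "\<psi> (v m) = \<psi> q \<circ> u \<circ> shift n"
            using walk[of m] by blast
          have "\<psi> (v m) \<in> (\<lambda>(u, n). \<psi> q \<circ> u \<circ> shift n) ` (lamp_prods g Y i \<times> {- ?M..?M})"
            using u by (intro image_eqI[of _ _ "(u, n)"]) auto
          then have "\<psi> (v m) \<in> L"
            unfolding L_def using maps[OF vX] m by simp
          with vX m show "v m \<in> (\<Union>h\<in>L. {f \<in> lamp_elems g X. \<psi> f = h})"
            by simp
        qed
      qed
      also have "\<dots> \<le> (\<Sum>h\<in>L. card {f \<in> lamp_elems g X. \<psi> f = h})"
        by (rule card_UN_le[OF finL])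
      also have "\<dots> \<le> card L * i"
        using sum_bounded_above[of L "\<lambda>h. card {f \<in> lamp_elems g X. \<psi> f = h}" i] fib
        by (simp add: L_def)
      also have "\<dots> \<le> i * (lamp_bound g i * (12 * ?r + 1))"
        using cardL by (simp add: mult.commute)
      finally show False using long by simp
    qed
  qed
  \<comment> \<open>A fifth is at least a quarter only for the empty set, but \<open>Q\<close>
    contains \<open>id\<close>.\<close>
  with sparse have "card conj_prods = 0" by linarith
  then show False
    using finite_conj_prods conj_prods_id by auto
qed

end

section \<open>The groups and their copies on the natural numbers\<close>

definition lamp_group :: "(nat \<Rightarrow> nat) \<Rightarrow> nat set \<Rightarrow> (point \<Rightarrow> point) monoid" where
  "lamp_group g X = \<lparr>carrier = lamp_elems g X, monoid.mult = (\<circ>), one = id\<rparr>"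

lemma lamp_group_simps [simp]:
  "carrier (lamp_group g X) = lamp_elems g X" "monoid.mult (lamp_group g X) = (\<circ>)" "one (lamp_group g X) = id"
  by (simp_all add: lamp_group_def)

lemma group_lamp_group: "group (lamp_group g X)"
proof (rule groupI)
  show "\<exists>h\<in>carrier (lamp_group g X). h \<otimes>\<^bsub>lamp_group g X\<^esub> f = \<one>\<^bsub>lamp_group g X\<^esub>"
    if "f \<in> carrier (lamp_group g X)" for f
    using that lamp_elems_inverse[of f g X] by auto
qed (simp_all add: lamp_elems_comp lamp_elems_id comp_assoc del: id_apply)

lemma lamp_gens_subset: "lamp_gens g X \<subseteq> carrier (lamp_group g X)"
  by (simp add: lamp_elems_gens subsetI)

lemma inv_lamp_gens:
  assumes "u \<in> lamp_gens g X"
  shows "inv\<^bsub>lamp_group g X\<^esub> u \<in> lamp_gens g X"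
proof -
  interpret group "lamp_group g X" by (rule group_lamp_group)
  obtain v where v: "v \<in> lamp_gens g X" "v \<circ> u = id"
    using lamp_gens_inverse[OF assms] by blast
  have "inv\<^bsub>lamp_group g X\<^esub> u = v"
    using v assms lamp_gens_subset[of g X] by (intro inv_equality) auto
  with v(1) show ?thesis by simp
qed

lemma generate_lamp_gens: "generate (lamp_group g X) (lamp_gens g X) = carrier (lamp_group g X)"
proof
  interpret group "lamp_group g X" by (rule group_lamp_group)
  show "generate (lamp_group g X) (lamp_gens g X) \<subseteq> carrier (lamp_group g X)"
    using generate_in_carrier[OF lamp_gens_subset] by blast
  have "comp_list l \<in> generate (lamp_group g X) (lamp_gens g X)" if "l \<in> lists (lamp_gens g X)" for l
    using that
  proof (induction l)
    case Nil
    show ?case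
      using generate.one[of "lamp_group g X"] by (simp only: comp_list_simps lamp_group_simps)
  next
    case (Cons u l)
    then show ?case
      using generate.eng[OF generate.incl[OF Cons.hyps(1)] Cons.IH]
      by (simp only: comp_list_simps lamp_group_simps)
  qed
  then show "carrier (lamp_group g X) \<subseteq> generate (lamp_group g X) (lamp_gens g X)"
    by (auto simp: lamp_elems_def simp del: in_lists_conv_set)
qed

lemma finite_lamp_gens: "finite (lamp_gens g X)"
  by (simp add: lamp_gens_def)

lemma countable_lamp_elems: "countable (lamp_elems g X)"
  unfolding lamp_elems_def
  by (intro countable_image countable_lists countable_finite finite_lamp_gens)

definition nat_lamp_group :: "(nat \<Rightarrow> nat) \<Rightarrow> nat set \<Rightarrow> nat monoid" where
  "nat_lamp_group g X = image_group (to_nat_on (lamp_elems g X)) (lamp_group g X)"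

lemma inj_encode: "inj_on (to_nat_on (lamp_elems g X)) (carrier (lamp_group g X))"
  by (simp add: inj_on_to_nat_on countable_lamp_elems)

lemma group_nat_lamp_group: "group (nat_lamp_group g X)"
  unfolding nat_lamp_group_def
  by (rule group.inj_imp_image_group_is_group[OF group_lamp_group inj_encode])

lemma encode_iso: "to_nat_on (lamp_elems g X) \<in> iso (lamp_group g X) (nat_lamp_group g X)"
  unfolding nat_lamp_group_def
  by (rule inj_imp_image_group_iso[OF inj_encode])

lemma group_hom_encode: "group_hom (lamp_group g X) (nat_lamp_group g X) (to_nat_on (lamp_elems g X))"
  using encode_iso group_lamp_group group_nat_lamp_group
  by (intro group_hom.intro group_hom_axioms.intro) (auto simp: iso_def)

lemma carrier_nat_lamp_group: "carrier (nat_lamp_group g X) = to_nat_on (lamp_elems g X) ` lamp_elems g X"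
  by (simp add: nat_lamp_group_def image_group_carrier)

lemma generate_nat_lamp_group:
  "generate (nat_lamp_group g X) (to_nat_on (lamp_elems g X) ` lamp_gens g X) = carrier (nat_lamp_group g X)"
  using group_hom.generate_img[OF group_hom_encode lamp_gens_subset] generate_lamp_gens
  by (simp add: carrier_nat_lamp_group)

lemma finitely_generated_nat_lamp_group: "finitely_generated_group (nat_lamp_group g X)"
proof -
  have "finite_generating_set (nat_lamp_group g X) (to_nat_on (lamp_elems g X) ` lamp_gens g X)"
    unfolding finite_generating_set_def
    using finite_lamp_gens lamp_gens_subset[of g X] generate_nat_lamp_group[of g X]
    by (auto simp: carrier_nat_lamp_group)
  then show ?thesis
    unfolding finitely_generated_group_def using group_nat_lamp_group by blast
qed

text \<open>A regular map has one Lipschitz constant and one fibre bound; some \<open>i\<close> in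
  the infinite set \<open>X - Y\<close> exceeds both, and \<open>no_coarse_map\<close> applies to
  the map transported along the encodings.\<close>

lemma no_regular_map_nat_lamp_group:
  assumes long: "\<And>i. i * (lamp_bound g i * (12 * reach i + 1)) < g i"
    and inf: "infinite (X - Y)"
    and S: "finite_generating_set (nat_lamp_group g X) S"
    and T: "finite_generating_set (nat_lamp_group g Y) T"
  shows "\<not> regular_map (cayley_graph (nat_lamp_group g X) S) (cayley_graph (nat_lamp_group g Y) T) \<phi>"
proof
  assume reg: "regular_map (cayley_graph (nat_lamp_group g X) S) (cayley_graph (nat_lamp_group g Y) T) \<phi>"
  define e where "e = (\<lambda>X. to_nat_on (lamp_elems g X))"
  define d where "d = (\<lambda>X. from_nat_into (lamp_elems g X))"
  interpret HX: group_hom "lamp_group g X" "nat_lamp_group g X" "e X"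
    unfolding e_def by (rule group_hom_encode)
  interpret HY: group_hom "lamp_group g Y" "nat_lamp_group g Y" "e Y"
    unfolding e_def by (rule group_hom_encode)
  have de: "d Z (e Z f) = f" if "f \<in> lamp_elems g Z" for f Z
    unfolding d_def e_def using countable_lamp_elems that by (rule from_nat_into_to_nat_on)
  have ed: "d Z n \<in> lamp_elems g Z" "e Z (d Z n) = n" if "n \<in> carrier (nat_lamp_group g Z)" for n Z
    using that de[of _ Z] by (auto simp: carrier_nat_lamp_group e_def)
  have e_gens: "e Z ` lamp_gens g Z \<subseteq> carrier (nat_lamp_group g Z)" for Z
    using lamp_gens_subset[of g Z] by (auto simp: carrier_nat_lamp_group e_def)
  have "\<exists>K. \<forall>a\<in>carrier (nat_lamp_group g X). \<forall>b\<in>e X ` lamp_gens g X. \<exists>l\<in>lists (e Y ` lamp_gens g Y).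
      length l \<le> K \<and> \<phi> (a \<otimes>\<^bsub>nat_lamp_group g X\<^esub> b) = \<phi> a \<otimes>\<^bsub>nat_lamp_group g Y\<^esub> HY.H.word_prod l"
  proof (rule regular_map_imp_words[OF group_nat_lamp_group group_nat_lamp_group S T reg])
    show "generate (nat_lamp_group g Y) (e Y ` lamp_gens g Y) = carrier (nat_lamp_group g Y)"
      unfolding e_def by (rule generate_nat_lamp_group)
    show "inv\<^bsub>nat_lamp_group g Y\<^esub> b \<in> e Y ` lamp_gens g Y" if b: "b \<in> e Y ` lamp_gens g Y" for b
    proof -
      obtain u where u: "u \<in> lamp_gens g Y" "b = e Y u"
        using b by blast
      then have "inv\<^bsub>nat_lamp_group g Y\<^esub> b = e Y (inv\<^bsub>lamp_group g Y\<^esub> u)"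
        using lamp_gens_subset[of g Y] by (simp add: HY.hom_inv subset_iff)
      with inv_lamp_gens[OF u(1)] show ?thesis by simp
    qed
  qed (use finite_lamp_gens e_gens in auto)
  then obtain K where K: "\<And>a b. a \<in> carrier (nat_lamp_group g X) \<Longrightarrow> b \<in> e X ` lamp_gens g X \<Longrightarrow>
      \<exists>l\<in>lists (e Y ` lamp_gens g Y). length l \<le> K \<and>
        \<phi> (a \<otimes>\<^bsub>nat_lamp_group g X\<^esub> b) = \<phi> a \<otimes>\<^bsub>nat_lamp_group g Y\<^esub> HY.H.word_prod l"
    by blast
  obtain N where N: "\<And>v. v \<in> carrier (nat_lamp_group g Y) \<Longrightarrow>
      finite {x \<in> carrier (nat_lamp_group g X). \<phi> x = v} \<and> card {x \<in> carrier (nat_lamp_group g X). \<phi> x = v} \<le> N"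
    and \<phi>: "\<And>x. x \<in> carrier (nat_lamp_group g X) \<Longrightarrow> \<phi> x \<in> carrier (nat_lamp_group g Y)"
    using reg by (auto simp: regular_map_def cayley_graph_simps image_subset_iff)
  \<comment> \<open>The sum dominates both constants, and the strict inequality makes
    \<open>i\<close> positive.\<close>
  obtain i where "K + N < i" "i \<in> X - Y"
    using inf unfolding infinite_nat_iff_unbounded by blast
  then have i: "K \<le> i" "N \<le> i" "0 < i" "i \<in> X" "i \<notin> Y"
    by auto
  define \<psi> where "\<psi> = (\<lambda>f. d Y (\<phi> (e X f)))"
  have eX: "e X f \<in> carrier (nat_lamp_group g X)" if "f \<in> lamp_elems g X" for f
    using that HX.hom_closed by simp
  have e\<psi>: "e Y (\<psi> f) = \<phi> (e X f)" and \<psi>: "\<psi> f \<in> lamp_elems g Y" if "f \<in> lamp_elems g X" for f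
    unfolding \<psi>_def using ed[OF \<phi>[OF eX[OF that]]] by simp_all
  have word: "\<exists>l'\<in>lists (lamp_gens g Y). l = map (e Y) l' \<and> HY.H.word_prod l = e Y (comp_list l')"
    if "l \<in> lists (e Y ` lamp_gens g Y)" for l
    using that
  proof (induction l)
    case Nil
    show ?case using HY.hom_one
      by (intro bexI[of _ "[]"]) (simp_all only: list.map HY.H.word_prod_simps comp_list_simps lamp_group_simps lists.Nil simp_thms)
  next
    case (Cons b l)
    then obtain u l' where u: "u \<in> lamp_gens g Y" "b = e Y u"
      and l': "l' \<in> lists (lamp_gens g Y)" "l = map (e Y) l'" "HY.H.word_prod l = e Y (comp_list l')"
      by blast
    have "e Y (u \<circ> comp_list l') = e Y u \<otimes>\<^bsub>nat_lamp_group g Y\<^esub> e Y (comp_list l')"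
      using HY.hom_mult[of u "comp_list l'"] lamp_elems_gens[OF u(1)] lamp_elems_words[OF l'(1)] by simp
    then have "HY.H.word_prod (b # l) = e Y (comp_list (u # l'))"
      using u l' by (simp only: HY.H.word_prod_simps comp_list_simps)
    moreover have "b # l = map (e Y) (u # l')" "u # l' \<in> lists (lamp_gens g Y)"
      using u l' by simp_all
    ultimately show ?case by (intro bexI[of _ "u # l'"] conjI)
  qed
  show False
  proof (rule no_coarse_map[OF i(4,5,3) long, where \<psi> = \<psi>])
    show "\<psi> f \<in> lamp_elems g Y" if "f \<in> lamp_elems g X" for f
      using that by (rule \<psi>)
  next
    fix f u assume f: "f \<in> lamp_elems g X" and u: "u \<in> lamp_gens g X"
    have fu: "f \<circ> u \<in> lamp_elems g X"
      using f lamp_elems_gens[OF u] by (rule lamp_elems_comp)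
    obtain l where l: "l \<in> lists (e Y ` lamp_gens g Y)" "length l \<le> K"
      "\<phi> (e X f \<otimes>\<^bsub>nat_lamp_group g X\<^esub> e X u) = \<phi> (e X f) \<otimes>\<^bsub>nat_lamp_group g Y\<^esub> HY.H.word_prod l"
      using K[OF eX[OF f], of "e X u"] u by blast
    obtain l' where l': "l' \<in> lists (lamp_gens g Y)" "l = map (e Y) l'"
      "HY.H.word_prod l = e Y (comp_list l')"
      using word[OF l(1)] by blast
    have "e X f \<otimes>\<^bsub>nat_lamp_group g X\<^esub> e X u = e X (f \<circ> u)"
      using HX.hom_mult[of f u] f lamp_elems_gens[OF u] by simp
    moreover have "e Y (\<psi> f) \<otimes>\<^bsub>nat_lamp_group g Y\<^esub> e Y (comp_list l') = e Y (\<psi> f \<circ> comp_list l')"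
      using HY.hom_mult[of "\<psi> f" "comp_list l'"] \<psi>[OF f] lamp_elems_words[OF l'(1)] by simp
    ultimately have "e Y (\<psi> (f \<circ> u)) = e Y (\<psi> f \<circ> comp_list l')"
      using l(3) l'(3) e\<psi>[OF f] e\<psi>[OF fu] by simp
    then have "\<psi> (f \<circ> u) = \<psi> f \<circ> comp_list l'"
      using de[of _ Y] \<psi>[OF fu] lamp_elems_comp[OF \<psi>[OF f] lamp_elems_words[OF l'(1)]] by metis
    then show "\<exists>l\<in>lists (lamp_gens g Y). length l \<le> i \<and> \<psi> (f \<circ> u) = \<psi> f \<circ> comp_list l"
      using l' l(2) i(1) by (intro bexI[of _ l']) auto
  next
    fix h assume h: "h \<in> lamp_elems g Y"
    let ?A = "{f \<in> lamp_elems g X. \<psi> f = h}"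
    let ?B = "{x \<in> carrier (nat_lamp_group g X). \<phi> x = e Y h}"
    have "e Y h \<in> carrier (nat_lamp_group g Y)"
      using h HY.hom_closed by simp
    note B = N[OF this]
    have "inj_on (e X) ?A"
      by (rule inj_on_inverseI[of _ "d X"]) (simp add: de)
    moreover have "e X ` ?A \<subseteq> ?B"
      using eX e\<psi> by auto
    ultimately show "finite ?A \<and> card ?A \<le> i"
      using B i(2) by (meson card_inj_on_le inj_on_finite order.trans)
  qed
qed

section \<open>Choice of the radii and an almost disjoint family\<close>

lemma exists_fast_growing_radii:
  "\<exists>g. \<forall>i. i * (lamp_bound g i * (12 * reach i + 1)) < g i"
\<comment> \<open>The lower bound on \<open>g i\<close> involves only values of \<open>g\<close>
  below \<open>i\<close>, so \<open>g\<close> exists by recursion.\<close>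
proof (rule dependent_wellorder_choice)
  fix r i :: nat and g h :: "nat \<Rightarrow> nat"
  assume "\<And>j. j < i \<Longrightarrow> g j = h j"
  then have "lamp_bound g i = lamp_bound h i" by (rule lamp_bound_cong)
  then show "(i * (lamp_bound g i * (12 * reach i + 1)) < r) = (i * (lamp_bound h i * (12 * reach i + 1)) < r)"
    by simp
qed (use lessI in blast)

text \<open>
  For \<open>r \<noteq> s\<close> the floors of \<open>2 ^ k * r\<close> and \<open>2 ^ k * s\<close> differ for all large \<open>k\<close>, so these sets are
  almost disjoint.
\<close>

definition digits :: "real \<Rightarrow> nat set" where
  "digits r = range (\<lambda>k::nat. to_nat (\<lfloor>r * 2 ^ k\<rfloor>, k))"

lemma infinite_digits_Diff:
  assumes "r \<noteq> s"
  shows "infinite (digits r - digits s)"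
proof -
  obtain n :: nat where n: "1 / \<bar>r - s\<bar> < 2 ^ n"
    using real_arch_pow[of 2] by auto
  have ne: "\<lfloor>r * 2 ^ k\<rfloor> \<noteq> \<lfloor>s * 2 ^ k\<rfloor>" if "k \<ge> n" for k
  proof
    assume "\<lfloor>r * 2 ^ k\<rfloor> = \<lfloor>s * 2 ^ k\<rfloor>"
    then have "\<bar>r * 2 ^ k - s * 2 ^ k\<bar> < 1" by linarith
    then have "\<bar>r - s\<bar> * 2 ^ k < 1"
      by (simp add: abs_mult flip: left_diff_distrib)
    moreover have "1 < \<bar>r - s\<bar> * 2 ^ n"
      using n assms by (simp add: field_simps)
    moreover have "\<bar>r - s\<bar> * 2 ^ n \<le> \<bar>r - s\<bar> * 2 ^ k"
      using that by (intro mult_left_mono power_increasing) auto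
    ultimately show False by linarith
  qed
  \<comment> \<open>The component \<open>k\<close> makes the codes pairwise different, and a code
    common to \<open>r\<close> and \<open>s\<close> would force equal floors for the same
    \<open>k\<close>.\<close>
  let ?f = "\<lambda>k::nat. to_nat (\<lfloor>r * 2 ^ k\<rfloor>, k)"
  have "infinite (?f ` {n..})"
    by (subst finite_image_iff) (auto simp: inj_on_def infinite_Ici)
  moreover have "?f ` {n..} \<subseteq> digits r - digits s"
    using ne by (auto simp: digits_def)
  ultimately show ?thesis
    using finite_subset by blast
qed

theorem theorem1p2:
  shows "\<exists>G :: real \<Rightarrow> nat monoid.
    (\<forall>r. finitely_generated_group (G r)) \<and>
    (\<forall>r s. r \<noteq> s \<longrightarrow>
      (\<forall>S T. finite_generating_set (G r) S \<longrightarrow> finite_generating_set (G s) T \<longrightarrow>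
        \<not> (\<exists>\<phi>. regular_map (cayley_graph (G r) S) (cayley_graph (G s) T) \<phi>)))"
proof -
  \<comment> \<open>One choice of radii serves all real indices; only the set of active trees
    varies.\<close>
  obtain g where "\<And>i. i * (lamp_bound g i * (12 * reach i + 1)) < g i"
    using exists_fast_growing_radii by blast
  then show ?thesis
    using finitely_generated_nat_lamp_group no_regular_map_nat_lamp_group infinite_digits_Diff
    by (intro exI[of _ "\<lambda>r. nat_lamp_group g (digits r)"]) blast
qed

end
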